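(* Let $W_S=H_S\wr_X\mathrm{Sym}(X)$, where $H_S$ is a finite group, $M_S$ is the number of conjugacy classes of $H_S$, and $X$ is an infinite set, and let $S^{(W_S)}$ be a sufficiently large (that is, PCwr) generating set of $W_S$. Then the exponential rate of conjugacy growth of $W_S$ with respect to $S^{(W_S)}$ is $$\widetilde{H}^{\mathrm{conj}}_{W_S}=\limsup_{n\to\infty}\frac{\log\gamma_{W_S,S^{(W_S)}}(n)}{\sqrt n}=\pi\sqrt{\frac{2M_S}{3}}.$$
   Context: $\mathrm{Sym}(X)$ is the group of permutations of the infinite set $X$ with finite support. For a group $H$, $H^{(X)}$ is the group of functions $X\to H$ with finite support (value $1$ outside a finite set), and $H\wr_X\mathrm{Sym}(X):=H^{(X)}\rtimes\mathrm{Sym}(X)$, where $f\in\mathrm{Sym}(X)$ acts by $\psi\mapsto f(\psi)=\psi\circ f^{-1}$ and $(\varphi,f)(\psi,g)=(\varphi f(\psi),fg)$. For a group $G$ generated by a set $S$, the word length $\ell_{G,S}(g)$ is the smallest $n\ge0$ such that $g=s_1\cdots s_n$ with $s_i\in S\cup S^{-1}$; the conjugacy length $\kappa_{G,S}(g)$ is the smallest word length of an element of the conjugacy class of $g$; $\gamma_{G,S}(n)$ is the number of conjugacy classes of $G$ whose conjugacy length is $n$. The exponential rate of conjugacy growth (with this normalization) is $\widetilde{H}^{\mathrm{conj}}_{G,S}=\limsup_{n\to\infty}\log\gamma_{G,S}(n)/\sqrt n$. Sufficiently large (PCwr) generating sets of $W=H\wr_X\mathrm{Sym}(X)$: for $a\in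 H\setminus\{1\}$ and $u\in X$ let $\varphi_u^a\in H^{(X)}\subset W$ be the function with value $a$ at $u$ and $1$ elsewhere. Let $T_H=\{\varphi_u^a: a\in H\setminus\{1\},u\in X\}$ and let $T_X\subset\mathrm{Sym}(X)\subset W$ be the set of all transpositions $(x\ y)$ of distinct elements of $X$. Let $S=S_H\sqcup S_X$ with $S_H\subset T_H$, $S_X\subset T_X$. The transposition graph $\Gamma(S_X)$ has vertex set $X$ and an edge $\{x,y\}$ for each $(x\ y)\in S_X$. The set $S$ is PCwr ("partition-complete for wreath products") if (i) $\Gamma(S_X)$ is connected, and (ii) for all $L\ge0$ and all partitions $\lambda=(\lambda_1,\dots,\lambda_k)$ of $L$, $\Gamma(S_X)$ contains a forest of $k$ trees $T_1,\dots,T_k$, where $T_i$ has $\lambda_i$ vertices, including one vertex $x^{(i)}$ such that $\varphi_{x^{(i)}}^a\in S_H$ for all $a\in H\setminus\{1\}$. *)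

theory Defs
  imports
    "HOL-Algebra.Product_Groups"
    "HOL-Algebra.Group_Action"
    "HOL-Combinatorics.Permutations"
    "HOL-Library.Extended_Real"
begin

section \<open>Word length, conjugacy length and conjugacy growth\<close>

definition word_length :: "('a, 'b) monoid_scheme \<Rightarrow> 'a set \<Rightarrow> 'a \<Rightarrow> nat" where
  "word_length G S g =
     (LEAST n. \<exists>ws. length ws = n \<and> set ws \<subseteq> S \<union> m_inv G ` S \<and>
                    g = foldr (\<lambda>x y. x \<otimes>\<^bsub>G\<^esub> y) ws \<one>\<^bsub>G\<^esub>)"

definition conj_class :: "('a, 'b) monoid_scheme \<Rightarrow> 'a \<Rightarrow> 'a set" where
  "conj_class G x = orbit G (\<lambda>g h. g \<otimes>\<^bsub>G\<^esub> h \<otimes>\<^bsub>G\<^esub> inv\<^bsub>G\<^esub> g) x"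

definition conj_classes :: "('a, 'b) monoid_scheme \<Rightarrow> 'a set set" where
  "conj_classes G = conj_class G ` carrier G"

definition conj_length :: "('a, 'b) monoid_scheme \<Rightarrow> 'a set \<Rightarrow> 'a \<Rightarrow> nat" where
  "conj_length G S g = (LEAST n. n \<in> word_length G S ` conj_class G g)"

text \<open>
  The counting function is a natural number, so an infinite set of classes would count as \<open>0\<close>.
  This does not occur for partition-complete generating sets (below) over a finite base group.
\<close>

definition conj_growth :: "('a, 'b) monoid_scheme \<Rightarrow> 'a set \<Rightarrow> nat \<Rightarrow> nat" where
  "conj_growth G S n = card {conj_class G g | g. g \<in> carrier G \<and> conj_length G S g = n}"

text \<open>The term for \<open>n = 0\<close> is \<open>0\<close> because of division by zero; it does not affect the limsup.\<close>

definition conj_growth_rate :: "('a, 'b) monoid_scheme \<Rightarrow> 'a set \<Rightarrow> ereal" where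
  "conj_growth_rate G S =
     limsup (\<lambda>n. ereal (ln (real (conj_growth G S n)) / sqrt (real n)))"


section \<open>The permutational wreath product\<close>

definition fin_sym :: "'x set \<Rightarrow> ('x \<Rightarrow> 'x) set" where
  "fin_sym X = {f. f permutes X \<and> finite {x. f x \<noteq> x}}"

text \<open>
  The base group of finitely supported functions \<open>X \<rightarrow> H\<close> is \<open>sum_group X (\<lambda>_. H)\<close>,
  whose elements are extensional on \<open>X\<close>; hence the restrictions to \<open>X\<close> below.
\<close>

definition translate :: "'x set \<Rightarrow> ('x \<Rightarrow> 'x) \<Rightarrow> ('x \<Rightarrow> 'h) \<Rightarrow> 'x \<Rightarrow> 'h" where
  "translate X f \<psi> = (\<lambda>x\<in>X. \<psi> (Hilbert_Choice.inv f x))"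

definition wreath ::
  "('h, 'm) monoid_scheme \<Rightarrow> 'x set \<Rightarrow> (('x \<Rightarrow> 'h) \<times> ('x \<Rightarrow> 'x)) monoid" where
  "wreath H X =
     \<lparr>carrier = carrier (sum_group X (\<lambda>_. H)) \<times> fin_sym X,
      monoid.mult = (\<lambda>(\<phi>, f) (\<psi>, g). (\<phi> \<otimes>\<^bsub>sum_group X (\<lambda>_. H)\<^esub> translate X f \<psi>, f \<circ> g)),
      one = (\<one>\<^bsub>sum_group X (\<lambda>_. H)\<^esub>, id)\<rparr>"

lemma group_wreath:
  assumes "group H"
  shows "group (wreath H X)"
proof -
  interpret H: group H by fact
  have cs: "carrier (sum_group X (\<lambda>_. H)) =
      {x \<in> X \<rightarrow>\<^sub>E carrier H. finite {i \<in> X. x i \<noteq> \<one>\<^bsub>H\<^esub>}}"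
    by (rule carrier_sum_group) (rule assms)
  interpret B: group "sum_group X (\<lambda>_. H)" by (simp add: assms)
  have inv_fs: "Hilbert_Choice.inv f \<in> fin_sym X" if "f \<in> fin_sym X" for f
  proof -
    have p: "f permutes X" and fin: "finite {x. f x \<noteq> x}"
      using that by (auto simp: fin_sym_def)
    have "{x. Hilbert_Choice.inv f x \<noteq> x} \<subseteq> {x. f x \<noteq> x}"
      using permutes_inv_eq[OF p] by auto
    then show ?thesis
      using p fin permutes_inv[OF p] finite_subset by (auto simp: fin_sym_def)
  qed
  have comp_fs: "f \<circ> g \<in> fin_sym X" if "f \<in> fin_sym X" "g \<in> fin_sym X" for f g
  proof -
    have "{x. (f \<circ> g) x \<noteq> x} \<subseteq> {x. f x \<noteq> x} \<union> {x. g x \<noteq> x}" by auto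
    moreover have "finite ({x. f x \<noteq> x} \<union> {x. g x \<noteq> x})"
      using that by (simp add: fin_sym_def)
    ultimately show ?thesis
      using that permutes_compose by (auto simp: fin_sym_def intro: finite_subset)
  qed
  have translate_cl: "translate X f \<psi> \<in> carrier (sum_group X (\<lambda>_. H))"
    if f: "f \<in> fin_sym X" and \<psi>: "\<psi> \<in> carrier (sum_group X (\<lambda>_. H))" for f \<psi>
  proof -
    have p: "f permutes X" using f by (simp add: fin_sym_def)
    note pi = permutes_inv[OF p]
    have "{i \<in> X. translate X f \<psi> i \<noteq> \<one>\<^bsub>H\<^esub>} \<subseteq> f ` {i \<in> X. \<psi> i \<noteq> \<one>\<^bsub>H\<^esub>}"
    proof
      fix i assume "i \<in> {i \<in> X. translate X f \<psi> i \<noteq> \<one>\<^bsub>H\<^esub>}"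
      then have "Hilbert_Choice.inv f i \<in> {i \<in> X. \<psi> i \<noteq> \<one>\<^bsub>H\<^esub>}"
        using permutes_in_image[OF pi] by (auto simp: translate_def)
      moreover have "i = f (Hilbert_Choice.inv f i)"
        using permutes_inverses(1)[OF p] by simp
      ultimately show "i \<in> f ` {i \<in> X. \<psi> i \<noteq> \<one>\<^bsub>H\<^esub>}" by blast
    qed
    then have "finite {i \<in> X. translate X f \<psi> i \<noteq> \<one>\<^bsub>H\<^esub>}"
      using \<psi> by (auto simp: cs intro: finite_subset)
    then show ?thesis
      using \<psi> permutes_in_image[OF pi] by (auto simp: cs translate_def)
  qed
  show ?thesis
  proof (rule groupI)
    fix x y assume "x \<in> carrier (wreath H X)" "y \<in> carrier (wreath H X)"
    then show "x \<otimes>\<^bsub>wreath H X\<^esub> y \<in> carrier (wreath H X)"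
      using B.m_closed translate_cl comp_fs
      by (auto simp: wreath_def simp del: mult_sum_group)
  next
    show "\<one>\<^bsub>wreath H X\<^esub> \<in> carrier (wreath H X)"
      using B.one_closed permutes_id
      by (auto simp: wreath_def fin_sym_def simp del: one_sum_group)
  next
    fix x y z
    assume xyz: "x \<in> carrier (wreath H X)" "y \<in> carrier (wreath H X)" "z \<in> carrier (wreath H X)"
    obtain \<phi> f \<psi> g \<chi> h where e: "x = (\<phi>, f)" "y = (\<psi>, g)" "z = (\<chi>, h)"
      by (metis surj_pair)
    have pf: "f permutes X" and pg: "g permutes X"
      using xyz by (auto simp: e wreath_def fin_sym_def)
    have i: "Hilbert_Choice.inv (f \<circ> g) = Hilbert_Choice.inv g \<circ> Hilbert_Choice.inv f"
      by (rule o_inv_distrib) (use pf pg permutes_bij in auto)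
    have a: "Hilbert_Choice.inv f u \<in> X" "Hilbert_Choice.inv g u \<in> X" if "u \<in> X" for u
      using that permutes_in_image permutes_inv pf pg by metis+
    show "x \<otimes>\<^bsub>wreath H X\<^esub> y \<otimes>\<^bsub>wreath H X\<^esub> z = x \<otimes>\<^bsub>wreath H X\<^esub> (y \<otimes>\<^bsub>wreath H X\<^esub> z)"
      using xyz a
      by (auto simp: e wreath_def cs translate_def i o_assoc PiE_iff H.m_assoc
               intro!: restrict_ext)
  next
    fix x assume x: "x \<in> carrier (wreath H X)"
    obtain \<phi> f where e: "x = (\<phi>, f)" by (metis surj_pair)
    have c: "\<phi> \<in> carrier (sum_group X (\<lambda>_. H))" and f: "f \<in> fin_sym X"
      using x by (auto simp: e wreath_def)
    have p: "f permutes X" using f by (simp add: fin_sym_def)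
    have "translate X id \<phi> = \<phi>"
      using c by (auto simp: cs translate_def extensional_def PiE_iff)
    then show "\<one>\<^bsub>wreath H X\<^esub> \<otimes>\<^bsub>wreath H X\<^esub> x = x"
      using B.l_one[OF c] by (simp add: e wreath_def del: one_sum_group mult_sum_group)
    let ?f = "Hilbert_Choice.inv f"
    let ?y = "(m_inv (sum_group X (\<lambda>_. H)) (translate X ?f \<phi>), ?f)"
    have s: "translate X ?f \<phi> \<in> carrier (sum_group X (\<lambda>_. H))"
      by (rule translate_cl[OF inv_fs[OF f] c])
    have "?y \<in> carrier (wreath H X)"
      using B.inv_closed[OF s] inv_fs[OF f] by (simp add: wreath_def del: inv_sum_group)
    moreover have "?y \<otimes>\<^bsub>wreath H X\<^esub> x = \<one>\<^bsub>wreath H X\<^esub>"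
      using B.l_inv[OF s] permutes_inv_o(2)[OF p]
      by (simp add: e wreath_def del: one_sum_group mult_sum_group inv_sum_group)
    ultimately show "\<exists>y\<in>carrier (wreath H X). y \<otimes>\<^bsub>wreath H X\<^esub> x = \<one>\<^bsub>wreath H X\<^esub>" by blast
  qed
qed


section \<open>Partition-complete generating sets\<close>

definition single_elt ::
  "('h, 'm) monoid_scheme \<Rightarrow> 'x set \<Rightarrow> 'x \<Rightarrow> 'h \<Rightarrow> ('x \<Rightarrow> 'h) \<times> ('x \<Rightarrow> 'x)" where
  "single_elt H X u a = ((\<lambda>x\<in>X. if x = u then a else \<one>\<^bsub>H\<^esub>), id)"

definition transp_elt ::
  "('h, 'm) monoid_scheme \<Rightarrow> 'x set \<Rightarrow> 'x \<Rightarrow> 'x \<Rightarrow> ('x \<Rightarrow> 'h) \<times> ('x \<Rightarrow> 'x)" where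
  "transp_elt H X x y = (\<one>\<^bsub>sum_group X (\<lambda>_. H)\<^esub>, Transposition.transpose x y)"

definition T_H ::
  "('h, 'm) monoid_scheme \<Rightarrow> 'x set \<Rightarrow> (('x \<Rightarrow> 'h) \<times> ('x \<Rightarrow> 'x)) set" where
  "T_H H X = {single_elt H X u a | u a. u \<in> X \<and> a \<in> carrier H - {\<one>\<^bsub>H\<^esub>}}"

definition T_X ::
  "('h, 'm) monoid_scheme \<Rightarrow> 'x set \<Rightarrow> (('x \<Rightarrow> 'h) \<times> ('x \<Rightarrow> 'x)) set" where
  "T_X H X = {transp_elt H X x y | x y. x \<in> X \<and> y \<in> X \<and> x \<noteq> y}"

text \<open>Undirected simple graphs are given by a vertex set and a set of two-element edges.\<close>

definition transposition_graph ::
  "('h, 'm) monoid_scheme \<Rightarrow> 'x set \<Rightarrow> (('x \<Rightarrow> 'h) \<times> ('x \<Rightarrow> 'x)) set \<Rightarrow> 'x set set" where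
  "transposition_graph H X S_X =
     {{x, y} | x y. x \<in> X \<and> y \<in> X \<and> x \<noteq> y \<and> transp_elt H X x y \<in> S_X}"

definition graph_connected :: "'x set \<Rightarrow> 'x set set \<Rightarrow> bool" where
  "graph_connected V E \<longleftrightarrow>
     V \<noteq> {} \<and> (\<forall>u\<in>V. \<forall>v\<in>V. (u, v) \<in> {(a, b). a \<in> V \<and> b \<in> V \<and> {a, b} \<in> E}\<^sup>*)"

definition graph_cycle :: "'x set set \<Rightarrow> 'x list \<Rightarrow> bool" where
  "graph_cycle E xs \<longleftrightarrow>
     length xs \<ge> 3 \<and> distinct xs \<and>
     (\<forall>i<length xs. {xs ! i, xs ! (Suc i mod length xs)} \<in> E)"

definition graph_tree :: "'x set \<Rightarrow> 'x set set \<Rightarrow> bool" where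
  "graph_tree V E \<longleftrightarrow>
     E \<subseteq> {{a, b} | a b. a \<in> V \<and> b \<in> V \<and> a \<noteq> b} \<and>
     graph_connected V E \<and> \<not> (\<exists>xs. graph_cycle E xs)"

definition is_partition :: "nat \<Rightarrow> nat list \<Rightarrow> bool" where
  "is_partition L ls \<longleftrightarrow> sorted_wrt (\<ge>) ls \<and> (\<forall>l\<in>set ls. l > 0) \<and> sum_list ls = L"

text \<open>
  A forest of \<open>k\<close> trees is a family of \<open>k\<close> pairwise vertex-disjoint trees;
  they are subgraphs of the transposition graph, not necessarily induced ones.
\<close>

definition PCwr ::
  "('h, 'm) monoid_scheme \<Rightarrow> 'x set \<Rightarrow> (('x \<Rightarrow> 'h) \<times> ('x \<Rightarrow> 'x)) set \<Rightarrow> bool" where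
  "PCwr H X S \<longleftrightarrow>
     (\<exists>S_H S_X. S_H \<subseteq> T_H H X \<and> S_X \<subseteq> T_X H X \<and> S = S_H \<union> S_X \<and> S_H \<inter> S_X = {} \<and>
        graph_connected X (transposition_graph H X S_X) \<and>
        (\<forall>L ls. is_partition L ls \<longrightarrow>
           (\<exists>V E. (\<forall>i<length ls. graph_tree (V i) (E i) \<and> V i \<subseteq> X \<and>
                      E i \<subseteq> transposition_graph H X S_X \<and> card (V i) = ls ! i \<and>
                      (\<exists>x\<in>V i. \<forall>a\<in>carrier H - {\<one>\<^bsub>H\<^esub>}. single_elt H X x a \<in> S_H)) \<and>
                  (\<forall>i<length ls. \<forall>j<length ls. i \<noteq> j \<longrightarrow> V i \<inter> V j = {}))))"

end

theory Submission
  imports Defs "HOL-Combinatorics.Orbits" "HOL-Analysis.Analysis" "HOL-Real_Asymp.Real_Asymp"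
begin

text \<open>
  The conjugacy class of an element of the wreath product is determined by the multiset of its
  nontrivial cycles, each labelled with its length and the conjugacy class in \<open>H\<close> of its cycle
  product. A cycle of length \<open>k\<close> costs \<open>k - 1\<close> letters if its cycle product is trivial and \<open>k\<close>
  letters otherwise. Trees of transpositions give the upper bound. For the lower bound, join the
  points moved by the transpositions of a word and merge the points at which it has a letter from
  \<open>H\<close> with a ghost point: every component without the ghost point contains a trivial cycle, and the
  number of such components drops by at most one per letter. Recording each cycle by its cost
  thus turns conjugacy classes of length \<open>n\<close> into partitions of \<open>n\<close> whose parts are coloured with
  the conjugacy classes of \<open>H\<close>, with generating function \<open>\<Prod>k. (1 - q^k)^-M\<close>.

  At \<open>q = exp (- t)\<close> the logarithm of this product is at most \<open>M * pi^2 / (6 * t)\<close>, and asymptotic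
  to it as \<open>t\<close> tends to \<open>0\<close>. The first fact bounds the coefficients from above by optimising \<open>t\<close>;
  the second one contradicts a bound \<open>exp (c * sqrt n)\<close> on all coefficients with a smaller constant.
\<close>

section \<open>Coloured partitions\<close>

text \<open>The constant is the minimum over t of \<open>n * t + M * pi^2 / (6 * t)\<close>, divided
  by \<open>sqrt n\<close>. The \<open>pi^2 / 6\<close> in it is the Basel sum, which appears when
  \<open>- ln (1 - q^k)\<close> is expanded and the sum over k is carried out first. Since only a
  limsup is claimed, no asymptotic formula for single coefficients is required: it is enough that a
  power series whose coefficients are all too small is itself too small near q = 1.

  On the group side, letters cannot be charged to single cycles, because cycles merge and split
  again while a word is read. Components only become coarser, and this makes the count monotone. In
  the encoding by costs, the trivial class with cost k stands for a cycle of length k + 1 and any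
  other class with cost k for a cycle of length k. Fixed points with trivial label are the only
  cycles of cost 0; once they are left out, all M colours are on the same footing.\<close>

definition coloured_partitions :: "'c set \<Rightarrow> nat \<Rightarrow> ('c \<times> nat) multiset set" where
  "coloured_partitions C n = {A. set_mset A \<subseteq> C \<times> {1..} \<and> (\<Sum>t\<in>#A. snd t) = n}"

text \<open>Bounding the parts (through a finite \<open>I\<close>) and the multiplicities replaces
  the infinite product by a finite product of finite sums, so that the combinatorial identities need
  no convergence.\<close>

definition bounded_msets :: "'a set \<Rightarrow> nat \<Rightarrow> 'a multiset set" where
  "bounded_msets I J = {A. set_mset A \<subseteq> I \<and> (\<forall>t. count A t \<le> J)}"

lemma bij_betw_bounded_msets:
  assumes "finite I"
  shows "bij_betw (\<lambda>A. restrict (count A) I) (bounded_msets I J) (I \<rightarrow>\<^sub>E {..J})"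
proof (rule bij_betwI')
  fix A B assume "A \<in> bounded_msets I J" "B \<in> bounded_msets I J"
  then have "count A t = 0 \<and> count B t = 0" if "t \<notin> I" for t
    using that by (auto simp: bounded_msets_def count_eq_zero_iff)
  then show "(restrict (count A) I = restrict (count B) I) = (A = B)"
    by (metis multiset_eqI restrict_apply')
next
  fix A assume "A \<in> bounded_msets I J"
  then show "restrict (count A) I \<in> I \<rightarrow>\<^sub>E {..J}" by (auto simp: bounded_msets_def)
next
  fix m assume m: "m \<in> I \<rightarrow>\<^sub>E {..J}"
  define A where "A = (\<Sum>t\<in>I. replicate_mset (m t) t)"
  have c: "count A t = (if t \<in> I then m t else 0)" for t
    using assms by (simp add: A_def count_sum)
  have "A \<in> bounded_msets I J"
    using m by (auto simp: bounded_msets_def c PiE_iff simp flip: count_greater_zero_iff split: if_splits)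
  moreover have "m = restrict (count A) I"
    using m by (auto simp: c PiE_iff extensional_def)
  ultimately show "\<exists>A\<in>bounded_msets I J. m = restrict (count A) I" by blast
qed

lemma finite_bounded_msets: "finite I \<Longrightarrow> finite (bounded_msets I J)"
  using bij_betw_finite[OF bij_betw_bounded_msets[of I J]] by (simp add: finite_PiE)

text \<open>Distributivity: choosing one summand \<open>j\<close> from every factor is the same as
  choosing a multiplicity for every element of \<open>I\<close>.\<close>

lemma sum_bounded_msets:
  fixes q :: real
  assumes I: "finite I"
  shows "(\<Sum>A\<in>bounded_msets I J. q ^ (\<Sum>t\<in>#A. snd t)) = (\<Prod>t\<in>I. \<Sum>j\<le>J. q ^ (snd t * j))"
proof -
  have "(\<Prod>t\<in>I. \<Sum>j\<le>J. q ^ (snd t * j)) = (\<Sum>m\<in>I \<rightarrow>\<^sub>E {..J}. \<Prod>t\<in>I. q ^ (snd t * m t))"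
    using I by (simp add: prod_sum_PiE)
  also have "\<dots> = (\<Sum>A\<in>bounded_msets I J. \<Prod>t\<in>I. q ^ (snd t * count A t))"
    by (subst sum.reindex_bij_betw[OF bij_betw_bounded_msets[OF I], symmetric]) simp
  also have "\<dots> = (\<Sum>A\<in>bounded_msets I J. q ^ (\<Sum>t\<in>#A. snd t))"
  proof (rule sum.cong)
    fix A assume "A \<in> bounded_msets I J"
    then have "set_mset A \<subseteq> I" by (simp add: bounded_msets_def)
    then have "(\<Sum>t\<in>#A. snd t) = (\<Sum>t\<in>I. snd t * count A t)"
    proof (induction A)
      case (add a A)
      have "(\<Sum>t\<in>I. snd t * count (add_mset a A) t) = (\<Sum>t\<in>I. (if t = a then snd t else 0) + snd t * count A t)"
        by (rule sum.cong) auto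
      also have "\<dots> = snd a + (\<Sum>t\<in>I. snd t * count A t)"
        using I add.prems by (simp add: sum.distrib)
      finally show ?case using add by simp
    qed simp
    then show "(\<Prod>t\<in>I. q ^ (snd t * count A t)) = q ^ (\<Sum>t\<in>#A. snd t)"
      by (simp add: power_sum)
  qed simp
  finally show ?thesis ..
qed

text \<open>A pair \<open>t\<close> of multiplicity m contributes \<open>snd t * m\<close> to the
  total \<open>n\<close>, and both factors are at least 1. Truncation at \<open>n\<close> therefore
  loses nothing as far as the coefficient of \<open>q ^ n\<close> is concerned.\<close>

lemma coloured_partitions_subset:
  "coloured_partitions C n \<subseteq> bounded_msets (C \<times> {1..n}) n"
proof
  fix A assume A: "A \<in> coloured_partitions C n"
  have c1: "snd t * count A t \<le> n" if "t \<in># A" for t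
  proof -
    have "(\<Sum>s\<in>#replicate_mset (count A t) t. snd s) \<le> (\<Sum>s\<in>#A. snd s)"
      by (metis count_le_replicate_mset_subset_eq image_mset_union le_add1 le_refl mset_subset_eq_exists_conv sum_mset.union)
    then show ?thesis using A by (simp add: coloured_partitions_def mult.commute)
  qed
  have c2: "count A t \<ge> 1" "snd t \<ge> 1" if "t \<in># A" for t
    using A that by (force simp: coloured_partitions_def)+
  have "count A t \<le> n \<and> snd t \<le> n" if "t \<in># A" for t
  proof -
    have *: "count A t \<ge> 1" "snd t \<ge> 1" "snd t * count A t \<le> n"
      using c1 c2 that by blast+
    show ?thesis
      using mult_le_mono1[OF *(2), of "count A t"] mult_le_mono2[OF *(1), of "snd t"] *(3)
      unfolding mult_1 mult_1_right by linarith
  qed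
  then have le: "count A t \<le> n" "t \<in># A \<Longrightarrow> snd t \<le> n" for t
    by (cases "t \<in># A"; simp add: not_in_iff)+
  have "t \<in> C \<times> {1..n}" if "t \<in># A" for t
    using A le(2)[OF that] that by (cases t) (auto simp: coloured_partitions_def)
  then show "A \<in> bounded_msets (C \<times> {1..n}) n"
    using le(1) by (auto simp: bounded_msets_def)
qed

lemma finite_coloured_partitions: "finite C \<Longrightarrow> finite (coloured_partitions C n)"
  by (rule finite_subset[OF coloured_partitions_subset finite_bounded_msets]) simp

context
  fixes C :: "'c set"
  assumes C: "finite C"
begin

lemma prod_colours:
  fixes F :: "nat \<Rightarrow> real"
  shows "(\<Prod>t\<in>C \<times> A. F (snd t)) = (\<Prod>k\<in>A. F k) ^ card C"
proof -
  have "(\<Prod>t\<in>C \<times> A. F (snd t)) = (\<Prod>c\<in>C. \<Prod>k\<in>A. F k)"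
    using prod.cartesian_product[of "\<lambda>_. F" A C] by (simp add: case_prod_beta)
  then show ?thesis by simp
qed

lemma card_coloured_le_prod:
  fixes q :: real
  assumes "0 \<le> q"
  shows "card (coloured_partitions C n) * q ^ n \<le> (\<Prod>k=1..n. \<Sum>j\<le>n. q ^ (k * j)) ^ card C"
proof -
  have "card (coloured_partitions C n) * q ^ n = (\<Sum>A\<in>coloured_partitions C n. q ^ (\<Sum>t\<in>#A. snd t))"
    by (simp add: coloured_partitions_def)
  also have "\<dots> \<le> (\<Sum>A\<in>bounded_msets (C \<times> {1..n}) n. q ^ (\<Sum>t\<in>#A. snd t))"
    by (rule sum_mono2) (use C assms coloured_partitions_subset in \<open>auto intro: finite_bounded_msets\<close>)
  also have "\<dots> = (\<Prod>k=1..n. \<Sum>j\<le>n. q ^ (k * j)) ^ card C"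
    using C by (simp add: sum_bounded_msets prod_colours[of "\<lambda>k. \<Sum>j\<le>n. q ^ (k * j)"])
  finally show ?thesis .
qed

text \<open>Counterpart of \<open>card_coloured_le_prod\<close>: a truncation keeps only some of the
  coloured partitions of each weight, so grouping by weight gives an upper bound. \<open>J\<close>
  and then \<open>K\<close> are sent to infinity later.\<close>

lemma prod_le_sum_card_coloured:
  fixes q :: real
  assumes q: "0 \<le> q" and s: "summable (\<lambda>n. card (coloured_partitions C n) * q ^ n)"
  shows "(\<Prod>k=1..K. \<Sum>j\<le>J. q ^ (k * j)) ^ card C \<le> (\<Sum>n. card (coloured_partitions C n) * q ^ n)"
proof -
  define B where "B = bounded_msets (C \<times> {1..K}) J"
  define wt where "wt A = (\<Sum>t\<in>#A. snd t)" for A :: "('c \<times> nat) multiset"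
  have fB: "finite B" unfolding B_def using C by (intro finite_bounded_msets) auto
  have "(\<Prod>k=1..K. \<Sum>j\<le>J. q ^ (k * j)) ^ card C = (\<Sum>A\<in>B. q ^ wt A)"
    using C by (simp add: B_def wt_def sum_bounded_msets prod_colours[of "\<lambda>k. \<Sum>j\<le>J. q ^ (k * j)"])
  also have "\<dots> = (\<Sum>n\<in>wt ` B. \<Sum>A | A \<in> B \<and> wt A = n. q ^ wt A)"
    using fB by (intro sum.group[symmetric]) auto
  also have "\<dots> \<le> (\<Sum>n\<in>wt ` B. card (coloured_partitions C n) * q ^ n)"
  proof (rule sum_mono)
    fix n
    have "card {A \<in> B. wt A = n} \<le> card (coloured_partitions C n)"
      by (rule card_mono[OF finite_coloured_partitions[OF C]])
         (force simp: B_def wt_def bounded_msets_def coloured_partitions_def)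
    then show "(\<Sum>A | A \<in> B \<and> wt A = n. q ^ wt A) \<le> card (coloured_partitions C n) * q ^ n"
      using q by (simp add: mult_right_mono)
  qed
  also have "\<dots> \<le> (\<Sum>n. card (coloured_partitions C n) * q ^ n)"
    by (rule sum_le_suminf[OF s]) (use fB q in auto)
  finally show ?thesis .
qed

end

section \<open>The logarithm of the generating function\<close>

lemma sums_minus_ln:
  fixes x :: real
  assumes "0 \<le> x" "x < 1"
  shows "(\<lambda>m. x ^ Suc m / real (Suc m)) sums (- ln (1 - x))"
proof -
  have "(-1) ^ n * (- x) ^ n = x ^ n" for n by (simp flip: power_mult_distrib)
  then have "(\<lambda>n. x ^ n / real n) sums (- ln (1 - x))"
    using sums_minus[OF ln_series'[of "- x"]] assms by simp
  then show ?thesis by (subst sums_Suc_iff) simp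
qed

lemma exp_geometric:
  fixes a :: real
  assumes "0 < a"
  shows "exp (- a) * (1 / (1 - exp (- a))) = 1 / (exp a - 1)"
proof -
  define E where "E = exp a"
  have "E > 1" using assms by (simp add: E_def)
  then show ?thesis unfolding exp_minus E_def[symmetric] by (simp add: field_simps)
qed

text \<open>Expanding the logarithms and summing over \<open>k\<close> first gives, for each
  exponent m \<ge> 1, a geometric sum of at most \<open>1 / (exp (m * t) - 1)\<close>, hence of at
  most \<open>1 / (m * t)\<close>. The factor \<open>1 / m\<close> from the expansion turns this
  into the Basel sum.\<close>

lemma sum_minus_ln_le:
  fixes t :: real
  assumes t: "0 < t"
  shows "(\<Sum>k=1..n. - ln (1 - exp (- t) ^ k)) \<le> pi\<^sup>2 / (6 * t)"
proof (rule sums_le)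
  define q where "q = exp (- t)"
  have q: "0 < q" "q < 1" using t by (auto simp: q_def)
  show "(\<lambda>m. \<Sum>k=1..n. (exp (- t) ^ k) ^ Suc m / real (Suc m)) sums (\<Sum>k=1..n. - ln (1 - exp (- t) ^ k))"
    using q unfolding q_def[symmetric]
    by (intro sums_sum sums_minus_ln) (auto simp: power_less_one_iff)
  show "(\<lambda>m. 1 / t * (1 / (real m + 1)\<^sup>2)) sums (pi\<^sup>2 / (6 * t))"
    using sums_mult[OF inverse_squares_sums, of "1/t"] by (simp add: mult_ac add_ac)
  show "(\<Sum>k=1..n. (exp (- t) ^ k) ^ Suc m / real (Suc m)) \<le> 1 / t * (1 / (real m + 1)\<^sup>2)" for m
  proof -
    define r where "r = exp (- (real (Suc m) * t))"
    have r: "0 < r" "r < 1" using t by (auto simp: r_def)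
    have e: "(exp (- t) ^ k) ^ Suc m = r ^ k" for k
      by (simp add: r_def flip: exp_of_nat_mult) (simp add: algebra_simps flip: exp_of_nat_mult exp_add)
    have "(\<Sum>k=1..n. r ^ k) = r * (\<Sum>k<n. r ^ k)"
      by (simp add: sum_distrib_left sum.atLeast1_atMost_eq)
    also have "\<dots> \<le> r * (1 / (1 - r))"
      using r by (intro mult_left_mono) (auto simp: sum_gp_strict field_simps)
    also have "\<dots> = 1 / (exp (real (Suc m) * t) - 1)"
      unfolding r_def using t by (intro exp_geometric) simp
    also have "\<dots> \<le> 1 / (real (Suc m) * t)"
      using t exp_ge_add_one_self[of "real (Suc m) * t"]
      by (intro divide_left_mono) (simp_all only: mult_pos_pos, simp_all)
    finally have "(\<Sum>k=1..n. r ^ k) \<le> 1 / (real (Suc m) * t)" .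
    then have "(\<Sum>k=1..n. r ^ k) / real (Suc m) \<le> 1 / (real (Suc m) * t) / real (Suc m)"
      by (intro divide_right_mono) auto
    then show ?thesis
      unfolding e sum_divide_distrib[symmetric] by (simp add: power2_eq_square mult_ac add_ac)
  qed
qed

text \<open>The same exchange of sums, read from below: with only \<open>R\<close> terms the limit
  in \<open>K\<close> may be taken termwise, and it evaluates the geometric sums exactly.
  \<open>B\<close> stays abstract because it will be the logarithm of the power series divided by
  the number of colours.\<close>

lemma sum_inverse_expm1_le:
  fixes t :: real
  assumes t: "0 < t" and B: "\<And>K. (\<Sum>k=1..K. - ln (1 - exp (- t) ^ k)) \<le> B"
  shows "(\<Sum>m<R. 1 / (real (Suc m) * (exp (real (Suc m) * t) - 1))) \<le> B"
proof -
  have lim: "(\<lambda>K. \<Sum>k=1..K. (exp (- t) ^ k) ^ Suc m / real (Suc m))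
    \<longlonglongrightarrow> 1 / (real (Suc m) * (exp (real (Suc m) * t) - 1))" for m
  proof -
    define r where "r = exp (- (real (Suc m) * t))"
    have r: "0 < r" "r < 1" using t by (auto simp: r_def)
    have e: "(exp (- t) ^ k) ^ Suc m = r ^ k" for k
      by (simp add: r_def flip: exp_of_nat_mult) (simp add: algebra_simps flip: exp_of_nat_mult exp_add)
    have "(\<Sum>k=1..n. r ^ k) = r * (\<Sum>k<n. r ^ k)" for n
      by (simp add: sum_distrib_left sum.atLeast1_atMost_eq)
    moreover have "(\<lambda>n. r * (\<Sum>k<n. r ^ k)) \<longlonglongrightarrow> r * (1 / (1 - r))"
      using geometric_sums[of r] r by (intro tendsto_mult_left) (simp add: sums_def)
    moreover have "r * (1 / (1 - r)) = 1 / (exp (real (Suc m) * t) - 1)"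
      unfolding r_def using t by (intro exp_geometric) simp
    ultimately have "(\<lambda>n. \<Sum>k=1..n. r ^ k) \<longlonglongrightarrow> 1 / (exp (real (Suc m) * t) - 1)" by simp
    then have "(\<lambda>n. (\<Sum>k=1..n. r ^ k) / real (Suc m)) \<longlonglongrightarrow> 1 / (exp (real (Suc m) * t) - 1) / real (Suc m)"
      by (intro tendsto_divide) auto
    then show ?thesis unfolding e sum_divide_distrib[symmetric] by (simp add: mult_ac)
  qed
  have "(\<lambda>K. \<Sum>m<R. \<Sum>k=1..K. (exp (- t) ^ k) ^ Suc m / real (Suc m))
    \<longlonglongrightarrow> (\<Sum>m<R. 1 / (real (Suc m) * (exp (real (Suc m) * t) - 1)))"
    by (intro tendsto_sum lim)
  moreover have "(\<Sum>m<R. \<Sum>k=1..K. (exp (- t) ^ k) ^ Suc m / real (Suc m)) \<le> B" for K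
  proof -
    have "(\<Sum>m<R. \<Sum>k=1..K. (exp (- t) ^ k) ^ Suc m / real (Suc m))
      = (\<Sum>k=1..K. \<Sum>m<R. (exp (- t) ^ k) ^ Suc m / real (Suc m))" by (rule sum.swap)
    also have "\<dots> \<le> (\<Sum>k=1..K. - ln (1 - exp (- t) ^ k))"
    proof (rule sum_mono)
      fix k assume "k \<in> {1..K}"
      then have "0 \<le> exp (- t) ^ k" "exp (- t) ^ k < 1" using t by (auto simp: power_less_one_iff)
      note s = sums_minus_ln[OF this]
      show "(\<Sum>m<R. (exp (- t) ^ k) ^ Suc m / real (Suc m)) \<le> - ln (1 - exp (- t) ^ k)"
        unfolding sums_unique[OF s] by (rule sum_le_suminf[OF sums_summable[OF s]]) auto
    qed
    also have "\<dots> \<le> B" by (rule B)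
    finally show ?thesis .
  qed
  ultimately show ?thesis by (meson LIMSEQ_le_const2)
qed

section \<open>Bounds for the coefficients\<close>

lemma exp_minus_power_bounds:
  fixes t :: real
  assumes "0 < t" "1 \<le> k"
  shows "exp (- t) ^ k < 1" "0 < exp (- t) ^ k"
  using assms by (auto simp: power_less_one_iff)

lemma geometric_power_sums:
  fixes t :: real
  assumes "0 < t" "1 \<le> k"
  shows "(\<lambda>j. exp (- t) ^ (k * j)) sums (1 / (1 - exp (- t) ^ k))"
  using geometric_sums[of "exp (- t) ^ k"] exp_minus_power_bounds[OF assms]
  by (simp add: power_mult)

text \<open>A single coefficient times \<open>q ^ n\<close> is at most the whole product. For
  \<open>q = exp (- t)\<close> this costs the factor \<open>exp (n * t)\<close>, and
  \<open>t\<close> stays free for optimisation.\<close>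

lemma card_coloured_le_exp:
  fixes t :: real
  assumes C: "finite C" and t: "0 < t"
  shows "card (coloured_partitions C n) \<le> exp (n * t + card C * (pi\<^sup>2 / (6 * t)))"
proof -
  define q where "q = exp (- t)"
  have q: "0 < q" by (simp add: q_def)
  note qk = exp_minus_power_bounds[OF t, folded q_def]
  have "card (coloured_partitions C n) * q ^ n \<le> (\<Prod>k=1..n. \<Sum>j\<le>n. q ^ (k * j)) ^ card C"
    by (rule card_coloured_le_prod[OF C]) (use q in simp)
  also have "\<dots> \<le> (\<Prod>k=1..n. 1 / (1 - q ^ k)) ^ card C"
  proof (intro power_mono prod_mono conjI prod_nonneg sum_nonneg)
    fix k assume "k \<in> {1..n}"
    then have s: "(\<lambda>j. q ^ (k * j)) sums (1 / (1 - q ^ k))"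
      unfolding q_def by (intro geometric_power_sums t) simp
    show "(\<Sum>j\<le>n. q ^ (k * j)) \<le> 1 / (1 - q ^ k)"
      unfolding sums_unique[OF s] by (rule sum_le_suminf[OF sums_summable[OF s]]) (use q in auto)
  qed (use q in auto)
  also have "(\<Prod>k=1..n. 1 / (1 - q ^ k)) = exp (\<Sum>k=1..n. - ln (1 - q ^ k))"
    unfolding exp_sum[OF finite_atLeastAtMost]
    by (rule prod.cong) (use qk in \<open>auto simp: exp_minus field_simps\<close>)
  also have "\<dots> ^ card C = exp (card C * (\<Sum>k=1..n. - ln (1 - q ^ k)))"
    by (simp only: exp_of_nat_mult)
  also have "\<dots> \<le> exp (card C * (pi\<^sup>2 / (6 * t)))"
    using sum_minus_ln_le[OF t, of n, folded q_def] by (simp only: exp_le_cancel_iff) (intro mult_left_mono, auto)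
  finally have "card (coloured_partitions C n) * q ^ n * exp (n * t) \<le> exp (card C * (pi\<^sup>2 / (6 * t))) * exp (n * t)"
    by (rule mult_right_mono) simp
  moreover have "q ^ n * exp (n * t) = 1"
    by (simp add: q_def flip: exp_of_nat_mult exp_add)
  ultimately have "card (coloured_partitions C n) * 1 \<le> exp (card C * (pi\<^sup>2 / (6 * t))) * exp (n * t)"
    by (simp only: mult.assoc)
  then show ?thesis by (simp add: exp_add mult_ac)
qed

lemma coloured_partitions_series_ge:
  fixes t :: real
  assumes C: "finite C" and t: "0 < t" and s: "summable (\<lambda>n. card (coloured_partitions C n) * exp (- t) ^ n)"
  shows "card C * (\<Sum>m<R. 1 / (real (Suc m) * (exp (real (Suc m) * t) - 1)))
    \<le> ln (\<Sum>n. card (coloured_partitions C n) * exp (- t) ^ n)"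
proof (cases "card C = 0")
  case True
  \<comment> \<open>Without colours the left side is 0, so the series only has to be at least 1; the
    empty multiset provides this. The case is separate because the other one divides by
    \<open>card C\<close>.\<close>
  have "coloured_partitions C 0 = {{#}}"
  proof -
    have "A = {#}" if "A \<in> coloured_partitions C 0" for A
    proof (rule ccontr)
      assume "A \<noteq> {#}"
      then obtain t where "t \<in># A" by blast
      then show False using that by (force simp: coloured_partitions_def)
    qed
    then show ?thesis by (auto simp: coloured_partitions_def)
  qed
  then have "1 \<le> (\<Sum>n<1. card (coloured_partitions C n) * exp (- t) ^ n)" by simp
  also have "\<dots> \<le> (\<Sum>n. card (coloured_partitions C n) * exp (- t) ^ n)"
    by (rule sum_le_suminf[OF s]) auto
  finally show ?thesis using True by simp
next
  case False
  define q where "q = exp (- t)"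
  have q: "0 < q" by (simp add: q_def)
  note qk = exp_minus_power_bounds[OF t, folded q_def]
  define F where "F = (\<Sum>n. card (coloured_partitions C n) * q ^ n)"
  have "(\<Sum>k=1..K. - ln (1 - q ^ k)) \<le> ln F / card C" for K
  proof -
    \<comment> \<open>With \<open>K\<close> fixed, letting the multiplicity bound tend to infinity
      closes the geometric sums. The bound on the parts is removed inside
      \<open>sum_inverse_expm1_le\<close>.\<close>
    have "(\<lambda>J. (\<Prod>k=1..K. \<Sum>j\<le>J. q ^ (k * j)) ^ card C) \<longlonglongrightarrow> (\<Prod>k=1..K. 1 / (1 - q ^ k)) ^ card C"
    proof (intro tendsto_power tendsto_prod)
      fix k assume "k \<in> {1..K}"
      then show "(\<lambda>J. \<Sum>j\<le>J. q ^ (k * j)) \<longlonglongrightarrow> 1 / (1 - q ^ k)"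
        using geometric_power_sums[OF t, of k, folded q_def] by (simp add: sums_def_le)
    qed
    moreover have "(\<Prod>k=1..K. \<Sum>j\<le>J. q ^ (k * j)) ^ card C \<le> F" for J
      unfolding F_def using prod_le_sum_card_coloured[OF C _ s[folded q_def]] q by simp
    ultimately have "(\<Prod>k=1..K. 1 / (1 - q ^ k)) ^ card C \<le> F"
      by (meson LIMSEQ_le_const2)
    also have "(\<Prod>k=1..K. 1 / (1 - q ^ k)) = exp (\<Sum>k=1..K. - ln (1 - q ^ k))"
      unfolding exp_sum[OF finite_atLeastAtMost]
      by (rule prod.cong) (use qk in \<open>auto simp: exp_minus field_simps\<close>)
    also have "\<dots> ^ card C = exp (card C * (\<Sum>k=1..K. - ln (1 - q ^ k)))"
      by (simp only: exp_of_nat_mult)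
    finally have "card C * (\<Sum>k=1..K. - ln (1 - q ^ k)) \<le> ln F"
      by (subst ln_ge_iff) (auto intro: less_le_trans[OF exp_gt_zero])
    then show ?thesis using False by (simp add: field_simps)
  qed
  then have "(\<Sum>m<R. 1 / (real (Suc m) * (exp (real (Suc m) * t) - 1))) \<le> ln F / card C"
    unfolding q_def by (rule sum_inverse_expm1_le[OF t])
  then show ?thesis using False by (simp add: field_simps F_def q_def)
qed

text \<open>Under the assumed bound the logarithm of the series at \<open>exp (- t)\<close> is at
  most about \<open>c^2 / (4 * t)\<close>, the maximum of \<open>c * s - t * s^2\<close> over s. As
  \<open>t\<close> tends to 0 it is also at least about \<open>card C * pi^2 / (6 * t)\<close>.
  Multiplying by \<open>t\<close> and taking the limit compares the two constants.\<close>

lemma subexponential_growth_constant_ge: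
  fixes c :: real
  assumes C: "finite C" and c: "0 \<le> c" and K: "1 \<le> K"
    and le: "\<And>n. card (coloured_partitions C n) \<le> K * exp (c * sqrt n)"
  shows "2 * card C * pi\<^sup>2 / 3 \<le> c\<^sup>2"
proof -
  \<comment> \<open>\<open>d\<close> is the share of the decay \<open>exp (- t * n)\<close> that is
    reserved for summability, while the share \<open>1 - d\<close> has to absorb
    \<open>exp (c * sqrt n)\<close>. \<open>R\<close> keeps the sum finite while \<open>t\<close>
    tends to 0. Afterwards \<open>R\<close> tends to infinity and \<open>d\<close> to 0.\<close>
  have main: "card C * (\<Sum>m<R. 1 / (real m + 1)\<^sup>2) \<le> c\<^sup>2 / (4 * (1 - d))" if d: "0 < d" "d < 1" for d R
  proof (rule tendsto_le)
    show "((\<lambda>t. card C * (\<Sum>m<R. t / (real (Suc m) * (exp (real (Suc m) * t) - 1)))) \<longlongrightarrow>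
      card C * (\<Sum>m<R. 1 / (real m + 1)\<^sup>2)) (at_right 0)"
    proof (intro tendsto_mult_left tendsto_sum)
      fix m
      have "((\<lambda>t. t / (a * (exp (a * t) - 1))) \<longlongrightarrow> 1 / a\<^sup>2) (at_right 0)" if "a > 0" for a :: real
        using that by (real_asymp simp: field_simps power2_eq_square)
      from this[of "real (Suc m)"]
      show "((\<lambda>t. t / (real (Suc m) * (exp (real (Suc m) * t) - 1))) \<longlongrightarrow> 1 / (real m + 1)\<^sup>2) (at_right 0)"
        by (simp add: add_ac)
    qed
    \<comment> \<open>The factor \<open>t\<close> removes \<open>K\<close> and the contribution of
      the geometric series, because \<open>ln (1 - exp (- d * t))\<close> diverges only like
      \<open>ln t\<close>.\<close>
    show "((\<lambda>t. t * ln K + c\<^sup>2 / (4 * (1 - d)) + t * (- ln (1 - exp (- d * t)))) \<longlongrightarrow> c\<^sup>2 / (4 * (1 - d))) (at_right 0)"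
      using d by real_asymp
    show "\<forall>\<^sub>F t in at_right 0. card C * (\<Sum>m<R. t / (real (Suc m) * (exp (real (Suc m) * t) - 1)))
      \<le> t * ln K + c\<^sup>2 / (4 * (1 - d)) + t * (- ln (1 - exp (- d * t)))"
    proof (rule eventually_at_rightI[of 0 1])
      fix t :: real assume "t \<in> {0<..<1}"
      then have t: "0 < t" by simp
      \<comment> \<open>The maximum of \<open>c * s - (1 - d) * t * s^2\<close> over real s; it is
        used at \<open>s = sqrt n\<close>.\<close>
      define a where "a = c\<^sup>2 / (4 * (1 - d) * t)"
      define r where "r = exp (- d * t)"
      have r: "0 < r" "r < 1" using t d by (auto simp: r_def)
      have b: "card (coloured_partitions C n) * exp (- t) ^ n \<le> K * exp a * r ^ n" for n
      proof -
        define u where "u = (1 - d) * t"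
        have u: "0 < u" using d t by (simp add: u_def)
        have "0 \<le> (2 * u * sqrt n - c)\<^sup>2" by simp
        then have "4 * u * (c * sqrt n) \<le> 4 * u * (u * (sqrt n * sqrt n)) + c\<^sup>2"
          by (simp only: power2_eq_square algebra_simps)
        then have "4 * u * (c * sqrt n) \<le> 4 * u * (u * n) + c\<^sup>2" by simp
        then have "c * sqrt n \<le> u * n + c\<^sup>2 / (4 * u)" using u by (simp add: field_simps)
        then have "c * sqrt n + n * (- t) \<le> a + n * (- d * t)"
          by (simp add: a_def u_def algebra_simps)
        then have "K * exp (c * sqrt n + n * (- t)) \<le> K * exp (a + n * (- d * t))"
          using K by simp
        then have "K * exp (c * sqrt n) * exp (- t) ^ n \<le> K * exp a * r ^ n"
          by (simp only: exp_add r_def mult_ac flip: exp_of_nat_mult)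
        moreover have "card (coloured_partitions C n) * exp (- t) ^ n \<le> K * exp (c * sqrt n) * exp (- t) ^ n"
          by (rule mult_right_mono[OF le]) simp
        ultimately show ?thesis by linarith
      qed
      have g: "(\<lambda>n. K * exp a * r ^ n) sums (K * exp a * (1 / (1 - r)))"
        using r by (intro sums_mult geometric_sums) auto
      have s: "summable (\<lambda>n. card (coloured_partitions C n) * exp (- t) ^ n)"
        by (rule summable_comparison_test'[OF sums_summable[OF g], of 0]) (use b in auto)
      define F where "F = (\<Sum>n. card (coloured_partitions C n) * exp (- t) ^ n)"
      have F: "F \<le> K * exp a * (1 / (1 - r))"
        unfolding F_def sums_unique[OF g] by (intro suminf_le b s sums_summable[OF g])
      have "0 \<le> F" unfolding F_def by (rule suminf_nonneg[OF s]) simp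
      then have "ln F \<le> ln (K * exp a * (1 / (1 - r)))"
      proof (cases "F = 0")
        case True
        have "1 \<le> K * exp a * (1 / (1 - r))"
          using K r by (intro mult_ge1_I) (auto simp: a_def d less_imp_le t)
        then show ?thesis using True by simp
      qed (use F in auto)
      also have "\<dots> = ln K + a - ln (1 - r)"
        using K r by (simp add: ln_mult ln_div)
      finally have "card C * (\<Sum>m<R. 1 / (real (Suc m) * (exp (real (Suc m) * t) - 1))) \<le> ln K + a - ln (1 - r)"
        using coloured_partitions_series_ge[OF C t s, of R] by (simp only: F_def)
      then have "t * (card C * (\<Sum>m<R. 1 / (real (Suc m) * (exp (real (Suc m) * t) - 1)))) \<le> t * (ln K + a - ln (1 - r))"
        using t by simp
      moreover have "t * (card C * (\<Sum>m<R. 1 / (real (Suc m) * (exp (real (Suc m) * t) - 1))))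
        = card C * (\<Sum>m<R. t / (real (Suc m) * (exp (real (Suc m) * t) - 1)))"
        by (simp add: sum_distrib_left mult_ac)
      moreover have "t * (ln K + a - ln (1 - r)) = t * ln K + c\<^sup>2 / (4 * (1 - d)) + t * (- ln (1 - exp (- d * t)))"
        using t d by (simp add: a_def r_def field_simps)
      ultimately show "card C * (\<Sum>m<R. t / (real (Suc m) * (exp (real (Suc m) * t) - 1)))
        \<le> t * ln K + c\<^sup>2 / (4 * (1 - d)) + t * (- ln (1 - exp (- d * t)))" by linarith
    qed simp
  qed simp
  have "card C * (pi\<^sup>2 / 6) \<le> c\<^sup>2 / (4 * (1 - d))" if d: "0 < d" "d < 1" for d
  proof (rule LIMSEQ_le_const2)
    show "(\<lambda>R. card C * (\<Sum>m<R. 1 / (real m + 1)\<^sup>2)) \<longlonglongrightarrow> card C * (pi\<^sup>2 / 6)"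
      using inverse_squares_sums by (intro tendsto_mult_left) (simp add: sums_def add_ac)
  qed (use main d in blast)
  moreover have "((\<lambda>d. c\<^sup>2 / (4 * (1 - d))) \<longlongrightarrow> c\<^sup>2 / (4 * (1 - 0))) (at_right 0)"
    by (intro tendsto_intros) auto
  ultimately have "card C * (pi\<^sup>2 / 6) \<le> c\<^sup>2 / (4 * (1 - 0))"
    by (intro tendsto_lowerbound) (auto intro!: eventually_at_rightI[of 0 1])
  then show ?thesis by simp
qed

theorem limsup_ln_card_coloured_partitions:
  assumes C: "finite C" "C \<noteq> {}"
  shows "limsup (\<lambda>n. ereal (ln (real (card (coloured_partitions C n))) / sqrt n)) = ereal (pi * sqrt (2 * real (card C) / 3))"
    (is "limsup (\<lambda>n. ereal (?g n)) = ereal ?c")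
proof (rule antisym)
  have M: "0 < real (card C)" using C by (simp add: card_gt_0_iff)
  have cpos: "0 < ?c" using M by simp
  have csq: "?c\<^sup>2 = 2 * card C * pi\<^sup>2 / 3" by (simp add: power_mult_distrib)
  show "limsup (\<lambda>n. ereal (?g n)) \<le> ereal ?c"
  proof (rule Limsup_bounded, rule always_eventually, rule allI)
    fix n :: nat
    show "ereal (?g n) \<le> ereal ?c"
    \<comment> \<open>In both cases the quotient is 0, since division by 0 and \<open>ln 0\<close>
      give 0.\<close>
    proof (cases "n = 0 \<or> card (coloured_partitions C n) = 0")
      case True
      then show ?thesis using cpos by auto
    next
      case False
      define s where "s = sqrt n"
      have s: "0 < s" "real n = s\<^sup>2" using False by (auto simp: s_def)
      \<comment> \<open>The minimiser of \<open>n * t + card C * (pi^2 / (6 * t))\<close>; at this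
        point both summands equal \<open>?c * s / 2\<close>.\<close>
      define t where "t = ?c / (2 * s)"
      have t: "0 < t" using cpos s by (simp add: t_def)
      have "ln (card (coloured_partitions C n)) \<le> n * t + card C * (pi\<^sup>2 / (6 * t))"
        using card_coloured_le_exp[OF C(1) t, of n] False by (metis exp_le_cancel_iff exp_ln gr0I of_nat_0_less_iff)
      also have "card C * (pi\<^sup>2 / (6 * t)) = ?c\<^sup>2 / (4 * t)" unfolding csq by simp
      also have "n * t + ?c\<^sup>2 / (4 * t) = ?c * s"
      proof -
        have "n * (c / (2 * s)) + c\<^sup>2 / (4 * (c / (2 * s))) = c * s" if "0 < c" for c :: real
          using that s by (simp add: field_simps power2_eq_square)
        from this[OF cpos] show ?thesis by (simp only: t_def)
      qed
      finally show ?thesis using s by (simp add: s_def[symmetric] field_simps)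
    qed
  qed
  show "ereal ?c \<le> limsup (\<lambda>n. ereal (?g n))"
  proof (rule ccontr)
    assume "\<not> ereal ?c \<le> limsup (\<lambda>n. ereal (?g n))"
    then have "limsup (\<lambda>n. ereal (?g n)) < ereal ?c" by simp
    then obtain b where b: "limsup (\<lambda>n. ereal (?g n)) < ereal b" "ereal b < ereal ?c"
      using ereal_dense2 by blast
    \<comment> \<open>\<open>b\<close> may be negative. The maximum with \<open>?c / 2\<close> gives
      a positive constant still below \<open>?c\<close>, so that squares can be compared.\<close>
    define c where "c = max b (?c / 2)"
    have "?c / 2 \<le> c" "b < ?c" using b by (simp_all add: c_def)
    then have "0 < c" using cpos by linarith
    moreover have "c < ?c"
      using \<open>b < ?c\<close> cpos unfolding c_def max_less_iff_conj by linarith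
    ultimately have c: "0 < c" "c < ?c" by simp_all
    have "\<forall>\<^sub>F n in sequentially. ereal (?g n) < ereal b" by (rule Limsup_lessD[OF b(1)])
    then obtain N where N: "\<And>n. N \<le> n \<Longrightarrow> ?g n < b" by (auto simp: eventually_sequentially)
    \<comment> \<open>Absorbs the finitely many \<open>n\<close> for which the eventual bound may
      fail.\<close>
    define K where "K = Max (insert 1 ((\<lambda>n. real (card (coloured_partitions C n))) ` {..N}))"
    have K: "1 \<le> K" unfolding K_def by (intro Max_ge) auto
    have "card (coloured_partitions C n) \<le> K * exp (c * sqrt n)" for n
    proof (cases "n \<le> N")
      case True
      then have "real (card (coloured_partitions C n)) \<le> K" unfolding K_def by (intro Max_ge) auto
      also have "\<dots> \<le> K * exp (c * sqrt n)" using K c by simp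
      finally show ?thesis .
    next
      case False
      then have "0 < sqrt n" "?g n < b" using N[of n] by auto
      then have "ln (card (coloured_partitions C n)) < b * sqrt n" by (simp add: field_simps)
      also have "\<dots> \<le> c * sqrt n" by (intro mult_right_mono) (auto simp: c_def)
      finally have "real (card (coloured_partitions C n)) \<le> exp (c * sqrt n)"
        by (cases "card (coloured_partitions C n) = 0") (auto, metis exp_less_cancel_iff exp_ln less_imp_le gr0I of_nat_0_less_iff)
      also have "\<dots> \<le> K * exp (c * sqrt n)" using K by simp
      finally show ?thesis .
    qed
    then have "2 * card C * pi\<^sup>2 / 3 \<le> c\<^sup>2"
      using subexponential_growth_constant_ge[OF C(1) less_imp_le[OF c(1)] K] by blast
    moreover have "c\<^sup>2 < ?c\<^sup>2"
      by (rule power_strict_mono[OF c(2)]) (use c(1) in simp_all)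
    ultimately show False using csq by linarith
  qed
qed

section \<open>Conjugacy in the wreath product\<close>

context group
begin

lemma conj_class_eq: "conj_class G x = {g \<otimes> x \<otimes> inv g | g. g \<in> carrier G}"
  by (simp add: conj_class_def Group_Action.orbit_def)

text \<open>In this form no inverse occurs, so in the wreath product both sides can be evaluated
  point by point.\<close>

lemma mem_conj_class_iff:
  assumes "x \<in> carrier G"
  shows "y \<in> conj_class G x \<longleftrightarrow> y \<in> carrier G \<and> (\<exists>g\<in>carrier G. g \<otimes> x = y \<otimes> g)"
proof
  assume "y \<in> conj_class G x"
  then obtain g where "g \<in> carrier G" "y = g \<otimes> x \<otimes> inv g" by (auto simp: conj_class_eq)
  then show "y \<in> carrier G \<and> (\<exists>g\<in>carrier G. g \<otimes> x = y \<otimes> g)"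
    using assms by (auto intro!: bexI[of _ g] simp: m_assoc)
next
  assume "y \<in> carrier G \<and> (\<exists>g\<in>carrier G. g \<otimes> x = y \<otimes> g)"
  then obtain g where g: "y \<in> carrier G" "g \<in> carrier G" "g \<otimes> x = y \<otimes> g" by blast
  then have "y = g \<otimes> x \<otimes> inv g" by (simp add: m_assoc)
  then show "y \<in> conj_class G x" unfolding conj_class_eq using g(2) by blast
qed

lemma conj_class_self: "x \<in> carrier G \<Longrightarrow> x \<in> conj_class G x"
  by (auto simp: mem_conj_class_iff intro!: bexI[of _ \<one>])

lemma conj_class_eq_iff:
  assumes x: "x \<in> carrier G" and y: "y \<in> carrier G"
  shows "conj_class G x = conj_class G y \<longleftrightarrow> (\<exists>g\<in>carrier G. g \<otimes> x = y \<otimes> g)"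
proof
  assume "conj_class G x = conj_class G y"
  then show "\<exists>g\<in>carrier G. g \<otimes> x = y \<otimes> g"
    using conj_class_self[OF y] mem_conj_class_iff[OF x] by auto
next
  have sub: "conj_class G u \<subseteq> conj_class G v"
    if u: "u \<in> carrier G" and v: "v \<in> carrier G" and g: "g \<in> carrier G" "g \<otimes> v = u \<otimes> g" for u v g
  proof
    fix w assume "w \<in> conj_class G u"
    then obtain h where h: "w \<in> carrier G" "h \<in> carrier G" "h \<otimes> u = w \<otimes> h"
      using mem_conj_class_iff[OF u] by auto
    then have "(h \<otimes> g) \<otimes> v = w \<otimes> (h \<otimes> g)"
      using u v g by (metis m_assoc)
    then show "w \<in> conj_class G v" using h g by (auto simp: mem_conj_class_iff[OF v])
  qed
  assume "\<exists>g\<in>carrier G. g \<otimes> x = y \<otimes> g"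
  then obtain g where g: "g \<in> carrier G" "g \<otimes> x = y \<otimes> g" by blast
  then have "inv g \<otimes> y = x \<otimes> inv g"
    using x y by (metis inv_closed inv_solve_left inv_solve_right m_assoc m_closed)
  then show "conj_class G x = conj_class G y"
    using sub[OF x y] sub[OF y x] g by blast
qed

text \<open>This is what allows \<open>cycle_class\<close> to decide from the class alone whether
  the cycle product is trivial.\<close>

lemma conj_class_eq_one_iff:
  assumes "x \<in> carrier G" shows "conj_class G x = {\<one>} \<longleftrightarrow> x = \<one>"
proof
  show "conj_class G x = {\<one>}" if "x = \<one>"
    using that by (auto simp: conj_class_eq intro!: exI[of _ \<one>])
qed (use conj_class_self[OF assms] in auto)

end

section \<open>Cyclic permutations and cycle types\<close>

lemma cyclic_on_funpow:
  assumes "cyclic_on f A" "x \<in> A"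
  shows bij_betw_cyclic_on: "bij_betw (\<lambda>i. (f ^^ i) x) {..<card A} A"
    and funpow_card_cyclic_on: "(f ^^ card A) x = x"
proof -
  have A: "A = Orbits.orbit f x" and x: "x \<in> Orbits.orbit f x"
    using assms by (auto simp: cyclic_on_alldef)
  have i: "inj_on (\<lambda>i. (f ^^ i) x) {0..<funpow_dist1 f x x}"
    by (rule inj_on_funpow_dist1[OF x])
  have e: "A = (\<lambda>i. (f ^^ i) x) ` {0..<funpow_dist1 f x x}"
    unfolding A by (rule orbit_conv_funpow_dist1[OF x])
  have c: "card A = funpow_dist1 f x x"
    by (subst e) (simp only: card_image[OF i] card_atLeastLessThan minus_nat.diff_0)
  show "bij_betw (\<lambda>i. (f ^^ i) x) {..<card A} A"
    using i e unfolding c bij_betw_def by (simp only: atLeast0LessThan)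
  show "(f ^^ card A) x = x" unfolding c by (rule funpow_dist1_prop[OF x])
qed

lemma cyclic_on_disjoint:
  assumes "cyclic_on f A" "cyclic_on f B" "A \<noteq> B"
  shows "A \<inter> B = {}"
  using assms by (auto simp: cyclic_on_alldef)

text \<open>
  A wreath product element \<open>(\<phi>, f)\<close> acts like \<open>f\<close> on points and picks up the factor \<open>\<phi> (f z)\<close> when
  moving \<open>z\<close> to \<open>f z\<close>; the factors are accumulated from right to left.
\<close>

primrec cycle_product ::
  "('h, 'm) monoid_scheme \<Rightarrow> ('x \<Rightarrow> 'h) \<times> ('x \<Rightarrow> 'x) \<Rightarrow> nat \<Rightarrow> 'x \<Rightarrow> 'h" where
  "cycle_product H g 0 x = \<one>\<^bsub>H\<^esub>"
| "cycle_product H g (Suc n) x = fst g ((snd g ^^ Suc n) x) \<otimes>\<^bsub>H\<^esub> cycle_product H g n x"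

text \<open>
  The second component is the number of letters needed for the cycle, not its length; this makes
  every pair with a positive second component possible.
\<close>

definition cycle_class ::
  "('h, 'm) monoid_scheme \<Rightarrow> ('x \<Rightarrow> 'h) \<times> ('x \<Rightarrow> 'x) \<Rightarrow> 'x set \<Rightarrow> 'h set \<times> nat" where
  "cycle_class H g A =
     (let c = conj_class H (cycle_product H g (card A) (SOME x. x \<in> A))
      in (c, if c = {\<one>\<^bsub>H\<^esub>} then card A - 1 else card A))"

text \<open>A fixed point with a nontrivial label counts as a cycle of its own. Leaving out the
  fixed points with trivial label makes the set finite for elements of the group and every remaining
  cost positive.\<close>

definition cycles_of ::
  "('h, 'm) monoid_scheme \<Rightarrow> 'x set \<Rightarrow> ('x \<Rightarrow> 'h) \<times> ('x \<Rightarrow> 'x) \<Rightarrow> 'x set set" where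
  "cycles_of H X g =
     {A. A \<subseteq> X \<and> cyclic_on (snd g) A \<and> (\<exists>x\<in>A. snd g x \<noteq> x \<or> fst g x \<noteq> \<one>\<^bsub>H\<^esub>)}"

definition cycle_type ::
  "('h, 'm) monoid_scheme \<Rightarrow> 'x set \<Rightarrow> ('x \<Rightarrow> 'h) \<times> ('x \<Rightarrow> 'x) \<Rightarrow> ('h set \<times> nat) multiset" where
  "cycle_type H X g = image_mset (cycle_class H g) (mset_set (cycles_of H X g))"

text \<open>
  The equation \<open>h g = g' h\<close> for \<open>h = (\<psi>, \<sigma>)\<close> and \<open>\<eta> = \<psi> \<circ> \<sigma>\<close>, evaluated at \<open>z\<close>. Unlike the equation
  itself, it can be studied on one cycle at a time.
\<close>

definition intertwines ::
  "('h, 'm) monoid_scheme \<Rightarrow> ('x \<Rightarrow> 'h) \<times> ('x \<Rightarrow> 'x) \<Rightarrow> ('x \<Rightarrow> 'h) \<times> ('x \<Rightarrow> 'x) \<Rightarrow>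
   ('x \<Rightarrow> 'x) \<Rightarrow> ('x \<Rightarrow> 'h) \<Rightarrow> 'x \<Rightarrow> bool" where
  "intertwines H g g' \<sigma> \<eta> z \<longleftrightarrow>
     \<sigma> (snd g z) = snd g' (\<sigma> z) \<and>
     \<eta> (snd g z) \<otimes>\<^bsub>H\<^esub> fst g (snd g z) = fst g' (snd g' (\<sigma> z)) \<otimes>\<^bsub>H\<^esub> \<eta> z"

section \<open>Pointwise calculation in the wreath product\<close>

locale wreath_product = H: group H for H :: "('h, 'm) monoid_scheme" +
  fixes X :: "'x set"
begin

abbreviation "W \<equiv> wreath H X"

sublocale W: group W
  by (rule group_wreath) (rule H.is_group)

lemma mem_carrier_W:
  "g \<in> carrier W \<longleftrightarrow> fst g \<in> X \<rightarrow>\<^sub>E carrier H \<and> finite {x \<in> X. fst g x \<noteq> \<one>\<^bsub>H\<^esub>} \<and>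
     snd g permutes X \<and> finite {x. snd g x \<noteq> x}"
  by (cases g) (auto simp: wreath_def fin_sym_def carrier_sum_group H.is_group)

lemma W_closed:
  assumes "g \<in> carrier W"
  shows fst_W_closed: "x \<in> X \<Longrightarrow> fst g x \<in> carrier H"
    and snd_W_closed: "snd g x \<in> X \<longleftrightarrow> x \<in> X"
    and funpow_W_closed: "(snd g ^^ n) x \<in> X \<longleftrightarrow> x \<in> X"
    and permutation_W: "permutation (snd g)"
proof -
  show "x \<in> X \<Longrightarrow> fst g x \<in> carrier H" "snd g x \<in> X \<longleftrightarrow> x \<in> X"
    using assms by (auto simp: mem_carrier_W permutes_in_image)
  then show "(snd g ^^ n) x \<in> X \<longleftrightarrow> x \<in> X"
    using assms by (induction n) (auto simp: mem_carrier_W permutes_in_image)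
  show "permutation (snd g)"
    using assms by (auto simp: mem_carrier_W permutation permutes_bij)
qed

lemma snd_W_mult [simp]: "snd (g \<otimes>\<^bsub>W\<^esub> h) = snd g \<circ> snd h"
  by (simp add: wreath_def case_prod_beta)

lemma snd_W_one [simp]: "snd \<one>\<^bsub>W\<^esub> = id"
  by (simp add: wreath_def)

lemma fst_W_one: "fst \<one>\<^bsub>W\<^esub> = (\<lambda>x\<in>X. \<one>\<^bsub>H\<^esub>)"
  by (simp add: wreath_def)

text \<open>Evaluation at \<open>snd g x\<close> instead of \<open>x\<close> cancels the inverse
  permutation in \<open>translate\<close>.\<close>

lemma fst_W_mult:
  assumes "g \<in> carrier W" "x \<in> X"
  shows "fst (g \<otimes>\<^bsub>W\<^esub> h) (snd g x) = fst g (snd g x) \<otimes>\<^bsub>H\<^esub> fst h x"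
proof -
  have p: "snd g permutes X" using assms by (simp add: mem_carrier_W)
  then show ?thesis
    using assms by (simp add: wreath_def case_prod_beta translate_def permutes_in_image[OF p] permutes_inverses[OF p])
qed

lemma W_eqI:
  assumes "g \<in> carrier W" "h \<in> carrier W" "snd g = snd h" "\<And>x. x \<in> X \<Longrightarrow> fst g x = fst h x"
  shows "g = h"
  using assms by (intro prod_eqI) (auto simp: mem_carrier_W intro: PiE_ext)

lemma intertwines_iff:
  assumes g: "g \<in> carrier W" and g': "g' \<in> carrier W" and h: "h \<in> carrier W"
  shows "h \<otimes>\<^bsub>W\<^esub> g = g' \<otimes>\<^bsub>W\<^esub> h \<longleftrightarrow> (\<forall>z\<in>X. intertwines H g g' (snd h) (\<lambda>z. fst h (snd h z)) z)"
proof
  assume e: "h \<otimes>\<^bsub>W\<^esub> g = g' \<otimes>\<^bsub>W\<^esub> h"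
  show "\<forall>z\<in>X. intertwines H g g' (snd h) (\<lambda>z. fst h (snd h z)) z"
  proof
    fix z assume z: "z \<in> X"
    have s: "snd h (snd g z) = snd g' (snd h z)"
      using arg_cong[OF e, of "\<lambda>k. snd k z"] by simp
    have "fst (h \<otimes>\<^bsub>W\<^esub> g) (snd h (snd g z)) = fst (g' \<otimes>\<^bsub>W\<^esub> h) (snd g' (snd h z))"
      by (simp only: e s)
    moreover have "fst (h \<otimes>\<^bsub>W\<^esub> g) (snd h (snd g z)) = fst h (snd h (snd g z)) \<otimes>\<^bsub>H\<^esub> fst g (snd g z)"
      "fst (g' \<otimes>\<^bsub>W\<^esub> h) (snd g' (snd h z)) = fst g' (snd g' (snd h z)) \<otimes>\<^bsub>H\<^esub> fst h (snd h z)"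
      using z by (auto intro!: fst_W_mult simp: g g' h snd_W_closed)
    ultimately show "intertwines H g g' (snd h) (\<lambda>z. fst h (snd h z)) z"
      using s by (simp add: intertwines_def)
  qed
next
  assume a: "\<forall>z\<in>X. intertwines H g g' (snd h) (\<lambda>z. fst h (snd h z)) z"
  have out: "snd k z = z" if "z \<notin> X" "k \<in> carrier W" for k z
    using that by (auto simp: mem_carrier_W permutes_not_in)
  show "h \<otimes>\<^bsub>W\<^esub> g = g' \<otimes>\<^bsub>W\<^esub> h"
  proof (rule W_eqI)
    show "snd (h \<otimes>\<^bsub>W\<^esub> g) = snd (g' \<otimes>\<^bsub>W\<^esub> h)"
    proof
      show "snd (h \<otimes>\<^bsub>W\<^esub> g) z = snd (g' \<otimes>\<^bsub>W\<^esub> h) z" for z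
        using a out[of z] g g' h by (cases "z \<in> X") (auto simp: intertwines_def)
    qed
    fix x assume x: "x \<in> X"
    \<comment> \<open>Products can be evaluated conveniently only at image points, so the given
      point is first written as one.\<close>
    have "snd h ` (snd g ` X) = X"
      using g h by (simp add: mem_carrier_W permutes_image)
    then obtain z where z: "x = snd h (snd g z)" "z \<in> X"
      using x by blast
    then have x': "x = snd g' (snd h z)" using a by (auto simp: intertwines_def)
    have "fst (h \<otimes>\<^bsub>W\<^esub> g) x = fst h x \<otimes>\<^bsub>H\<^esub> fst g (snd g z)"
      using fst_W_mult[OF h, of "snd g z" g] z snd_W_closed[OF g, of z] by simp
    also have "\<dots> = fst g' x \<otimes>\<^bsub>H\<^esub> fst h (snd h z)"
    proof -
      have "fst h (snd h (snd g z)) \<otimes>\<^bsub>H\<^esub> fst g (snd g z) = fst g' (snd g' (snd h z)) \<otimes>\<^bsub>H\<^esub> fst h (snd h z)"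
        using a z(2) unfolding intertwines_def by blast
      then show ?thesis by (simp only: z(1)[symmetric] x'[symmetric])
    qed
    also have "\<dots> = fst (g' \<otimes>\<^bsub>W\<^esub> h) x"
      using fst_W_mult[OF g', of "snd h z" h] z(2) snd_W_closed[OF h, of z] x' by simp
    finally show "fst (h \<otimes>\<^bsub>W\<^esub> g) x = fst (g' \<otimes>\<^bsub>W\<^esub> h) x" .
  qed (use g g' h in auto)
qed

section \<open>Cycle products as invariants of conjugacy\<close>

lemma cycle_product_closed:
  "g \<in> carrier W \<Longrightarrow> x \<in> X \<Longrightarrow> cycle_product H g n x \<in> carrier H"
  by (induction n) (auto simp: fst_W_closed snd_W_closed funpow_W_closed)

text \<open>Each intertwining equation moves \<eta> past one factor, and along an orbit these moves
  telescope. After a full cycle the two occurrences of \<eta> agree, and the equation says that the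
  cycle products are conjugate.\<close>

lemma cycle_product_intertwines:
  assumes g: "g \<in> carrier W" and g': "g' \<in> carrier W"
    and A: "A \<subseteq> X" "\<And>z. z \<in> A \<Longrightarrow> snd g z \<in> A"
    and \<sigma>: "\<And>z. z \<in> A \<Longrightarrow> \<sigma> z \<in> X" and \<eta>: "\<And>z. z \<in> A \<Longrightarrow> \<eta> z \<in> carrier H"
    and i: "\<And>z. z \<in> A \<Longrightarrow> intertwines H g g' \<sigma> \<eta> z" and z: "z \<in> A"
  shows "\<sigma> ((snd g ^^ n) z) = (snd g' ^^ n) (\<sigma> z)" (is ?P)
    and "cycle_product H g' n (\<sigma> z) \<otimes>\<^bsub>H\<^esub> \<eta> z = \<eta> ((snd g ^^ n) z) \<otimes>\<^bsub>H\<^esub> cycle_product H g n z" (is ?Q)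
proof -
  have "?P \<and> ?Q"
  proof (induction n)
    case 0
    then show ?case using \<eta>[OF z] by simp
  next
    case (Suc n)
    define y where "y = (snd g ^^ n) z"
    have y: "y \<in> A" unfolding y_def using A(2) z by (induction n) auto
    note c = fst_W_closed[OF g] fst_W_closed[OF g'] snd_W_closed[OF g] snd_W_closed[OF g'] \<sigma> \<eta>
      cycle_product_closed[OF g] cycle_product_closed[OF g'] A(2)
    have yX: "y \<in> X" "z \<in> X" using y z A by auto
    have s: "\<sigma> (snd g y) = snd g' (\<sigma> y)"
      and e: "\<eta> (snd g y) \<otimes>\<^bsub>H\<^esub> fst g (snd g y) = fst g' (snd g' (\<sigma> y)) \<otimes>\<^bsub>H\<^esub> \<eta> y"
      using i[OF y] by (auto simp: intertwines_def)
    have IH: "\<sigma> y = (snd g' ^^ n) (\<sigma> z)"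
      "cycle_product H g' n (\<sigma> z) \<otimes>\<^bsub>H\<^esub> \<eta> z = \<eta> y \<otimes>\<^bsub>H\<^esub> cycle_product H g n z"
      using Suc by (auto simp: y_def)
    have "cycle_product H g' (Suc n) (\<sigma> z) \<otimes>\<^bsub>H\<^esub> \<eta> z
      = fst g' (snd g' (\<sigma> y)) \<otimes>\<^bsub>H\<^esub> (cycle_product H g' n (\<sigma> z) \<otimes>\<^bsub>H\<^esub> \<eta> z)"
      using y z yX by (simp add: IH(1)[symmetric] H.m_assoc c)
    also have "\<dots> = (fst g' (snd g' (\<sigma> y)) \<otimes>\<^bsub>H\<^esub> \<eta> y) \<otimes>\<^bsub>H\<^esub> cycle_product H g n z"
      unfolding IH(2) using y z yX by (simp add: H.m_assoc c)
    also have "\<dots> = \<eta> (snd g y) \<otimes>\<^bsub>H\<^esub> (fst g (snd g y) \<otimes>\<^bsub>H\<^esub> cycle_product H g n z)"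
      unfolding e[symmetric] using y z yX by (simp add: H.m_assoc c)
    finally show ?case using s IH(1) by (simp add: y_def)
  qed
  then show ?P ?Q by auto
qed

text \<open>Every element commutes with itself: \<open>snd g\<close>, together with the labels
  \<open>fst g (snd g z)\<close>, intertwines \<open>g\<close> with \<open>g\<close>. Moving the
  base point one step along the cycle therefore conjugates the product.\<close>

lemma cycle_product_conj:
  assumes g: "g \<in> carrier W" and A: "A \<subseteq> X" "cyclic_on (snd g) A" and x: "x \<in> A" "y \<in> A"
  shows "conj_class H (cycle_product H g (card A) x) = conj_class H (cycle_product H g (card A) y)"
proof -
  note c = fst_W_closed[OF g] snd_W_closed[OF g] cycle_product_closed[OF g]
  have step: "conj_class H (cycle_product H g (card A) z) = conj_class H (cycle_product H g (card A) (snd g z))"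
    if z: "z \<in> A" for z
  proof -
    have zX: "z \<in> X" using z A by auto
    have "cycle_product H g (card A) (snd g z) \<otimes>\<^bsub>H\<^esub> fst g (snd g z)
      = fst g (snd g ((snd g ^^ card A) z)) \<otimes>\<^bsub>H\<^esub> cycle_product H g (card A) z"
      using A z by (intro cycle_product_intertwines(2)[OF g g, where A=A and \<eta>="\<lambda>z. fst g (snd g z)"])
        (auto intro: c cyclic_on_inI simp: intertwines_def c)
    also have "(snd g ^^ card A) z = z" by (rule funpow_card_cyclic_on[OF A(2) z])
    finally show ?thesis
      using zX by (subst H.conj_class_eq_iff) (auto simp: c intro!: bexI[of _ "fst g (snd g z)"])
  qed
  obtain n where n: "y = (snd g ^^ n) x"
    using bij_betw_cyclic_on[OF A(2) x(1)] x(2) by (auto simp: bij_betw_def)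
  have "conj_class H (cycle_product H g (card A) x) = conj_class H (cycle_product H g (card A) ((snd g ^^ n) x))"
  proof (induction n)
    case (Suc n)
    then show ?case using step[OF cyclic_on_funpow_in[OF A(2) x(1), of n]] by simp
  qed simp
  then show ?thesis using n by simp
qed

lemma cycle_class_eq:
  assumes g: "g \<in> carrier W" and A: "A \<subseteq> X" "cyclic_on (snd g) A" and x: "x \<in> A"
  shows "cycle_class H g A = (conj_class H (cycle_product H g (card A) x),
    if cycle_product H g (card A) x = \<one>\<^bsub>H\<^esub> then card A - 1 else card A)"
proof -
  have "(SOME x. x \<in> A) \<in> A" using x by (rule someI)
  then have "conj_class H (cycle_product H g (card A) (SOME x. x \<in> A)) = conj_class H (cycle_product H g (card A) x)"
    using cycle_product_conj[OF g A] x by blast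
  then show ?thesis
    using H.conj_class_eq_one_iff[OF cycle_product_closed[OF g]] x A(1)
    by (auto simp: cycle_class_def Let_def)
qed

lemma cycle_class_intertwines:
  assumes g: "g \<in> carrier W" and g': "g' \<in> carrier W"
    and A: "A \<subseteq> X" "cyclic_on (snd g) A"
    and \<sigma>: "inj_on \<sigma> A" "\<And>z. z \<in> A \<Longrightarrow> \<sigma> z \<in> X" and \<eta>: "\<And>z. z \<in> A \<Longrightarrow> \<eta> z \<in> carrier H"
    and i: "\<And>z. z \<in> A \<Longrightarrow> intertwines H g g' \<sigma> \<eta> z"
  shows "cyclic_on (snd g') (\<sigma> ` A)" and "cycle_class H g' (\<sigma> ` A) = cycle_class H g A"
proof -
  show c: "cyclic_on (snd g') (\<sigma> ` A)"
    using A(2) i by (intro cyclic_on_image) (auto simp: intertwines_def)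
  obtain x where x: "x \<in> A" using A(2) by (auto simp: cyclic_on_def)
  have k: "card (\<sigma> ` A) = card A" using \<sigma>(1) by (rule card_image)
  have "cycle_product H g' (card A) (\<sigma> x) \<otimes>\<^bsub>H\<^esub> \<eta> x = \<eta> ((snd g ^^ card A) x) \<otimes>\<^bsub>H\<^esub> cycle_product H g (card A) x"
    by (rule cycle_product_intertwines(2)[OF g g' A(1) _ \<sigma>(2) \<eta> i x]) (auto intro: cyclic_on_inI A)
  then have e: "\<eta> x \<otimes>\<^bsub>H\<^esub> cycle_product H g (card A) x = cycle_product H g' (card A) (\<sigma> x) \<otimes>\<^bsub>H\<^esub> \<eta> x"
    using funpow_card_cyclic_on[OF A(2) x] by simp
  have cl: "cycle_product H g (card A) x \<in> carrier H" "cycle_product H g' (card A) (\<sigma> x) \<in> carrier H"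
    using x A \<sigma> by (auto intro!: cycle_product_closed g g')
  have cc: "conj_class H (cycle_product H g (card A) x) = conj_class H (cycle_product H g' (card A) (\<sigma> x))"
    using e cl \<eta>[OF x] by (subst H.conj_class_eq_iff) auto
  have sub: "\<sigma> ` A \<subseteq> X" using \<sigma>(2) by blast
  have "cycle_product H g (card A) x = \<one>\<^bsub>H\<^esub> \<longleftrightarrow> cycle_product H g' (card A) (\<sigma> x) = \<one>\<^bsub>H\<^esub>"
    using H.conj_class_eq_one_iff cl cc by metis
  then show "cycle_class H g' (\<sigma> ` A) = cycle_class H g A"
    using cycle_class_eq[OF g A x] cycle_class_eq[OF g' sub c, of "\<sigma> x"] x cc by (auto simp: k)
qed

lemma cycles_ofD:
  assumes "A \<in> cycles_of H X g"
  shows "A \<subseteq> X" "cyclic_on (snd g) A" "finite A" "A \<noteq> {}"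
  using assms finite_cyclic_on[of "snd g" A] by (auto simp: cycles_of_def cyclic_on_def)

lemma finite_cycles_of:
  assumes "g \<in> carrier W"
  shows "finite (cycles_of H X g)"
proof (rule finite_subset)
  show "cycles_of H X g \<subseteq> Orbits.orbit (snd g) ` ({x. snd g x \<noteq> x} \<union> {x \<in> X. fst g x \<noteq> \<one>\<^bsub>H\<^esub>})"
  proof
    fix A assume "A \<in> cycles_of H X g"
    then obtain x where x: "A \<subseteq> X" "cyclic_on (snd g) A" "x \<in> A" "snd g x \<noteq> x \<or> fst g x \<noteq> \<one>\<^bsub>H\<^esub>"
      by (auto simp: cycles_of_def)
    then have "A = Orbits.orbit (snd g) x" by (auto simp: cyclic_on_alldef)
    then show "A \<in> Orbits.orbit (snd g) ` ({x. snd g x \<noteq> x} \<union> {x \<in> X. fst g x \<noteq> \<one>\<^bsub>H\<^esub>})"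
      using x by blast
  qed
qed (use assms in \<open>auto simp: mem_carrier_W\<close>)

lemma mem_Union_cycles_of_iff:
  assumes g: "g \<in> carrier W"
  shows "x \<in> \<Union>(cycles_of H X g) \<longleftrightarrow> x \<in> X \<and> (snd g x \<noteq> x \<or> fst g x \<noteq> \<one>\<^bsub>H\<^esub>)"
proof
  assume x: "x \<in> X \<and> (snd g x \<noteq> x \<or> fst g x \<noteq> \<one>\<^bsub>H\<^esub>)"
  have "Orbits.orbit (snd g) x \<in> cycles_of H X g"
    using x g cyclic_on_orbit'[OF permutation_W[OF g]] permutes_orbit_subset[of "snd g" X x]
      permutation_self_in_orbit[OF permutation_W[OF g], of x]
    by (auto simp: cycles_of_def mem_carrier_W)
  then show "x \<in> \<Union>(cycles_of H X g)"
    using permutation_self_in_orbit[OF permutation_W[OF g], of x] by blast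
next
  assume "x \<in> \<Union>(cycles_of H X g)"
  then obtain A y where A: "x \<in> A" "A \<subseteq> X" "cyclic_on (snd g) A" "y \<in> A" "snd g y \<noteq> y \<or> fst g y \<noteq> \<one>\<^bsub>H\<^esub>"
    by (auto simp: cycles_of_def)
  show "x \<in> X \<and> (snd g x \<noteq> x \<or> fst g x \<noteq> \<one>\<^bsub>H\<^esub>)"
  proof (cases "snd g x = x")
    case True
    then have "A = {x}" using A orbit_eq_singleton_iff[of "snd g" x] by (auto simp: cyclic_on_alldef)
    then show ?thesis using A by auto
  qed (use A in auto)
qed

lemma cycles_of_conj:
  assumes g: "g \<in> carrier W" and g': "g' \<in> carrier W" and h: "h \<in> carrier W"
    and e: "h \<otimes>\<^bsub>W\<^esub> g = g' \<otimes>\<^bsub>W\<^esub> h" and A: "A \<in> cycles_of H X g"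
  shows "snd h ` A \<in> cycles_of H X g'" and "cycle_class H g' (snd h ` A) = cycle_class H g A"
proof -
  note A' = cycles_ofD[OF A]
  have i: "intertwines H g g' (snd h) (\<lambda>z. fst h (snd h z)) z" if "z \<in> X" for z
    using that e intertwines_iff[OF g g' h] by blast
  have inj: "inj (snd h)" using h by (auto simp: mem_carrier_W permutes_inj)
  have sub: "snd h ` A \<subseteq> X" using A' h by (auto simp: snd_W_closed)
  have "cyclic_on (snd g') (snd h ` A) \<and> cycle_class H g' (snd h ` A) = cycle_class H g A"
    using cycle_class_intertwines[OF g g' A'(1,2) inj_on_subset[OF inj subset_UNIV], of "\<lambda>z. fst h (snd h z)"] A' i
    by (auto simp: snd_W_closed[OF h] fst_W_closed[OF h])
  moreover have "\<exists>x\<in>snd h ` A. snd g' x \<noteq> x \<or> fst g' x \<noteq> \<one>\<^bsub>H\<^esub>"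
  proof -
    obtain x where x: "x \<in> A" "snd g x \<noteq> x \<or> fst g x \<noteq> \<one>\<^bsub>H\<^esub>"
      using A by (auto simp: cycles_of_def)
    then have xX: "x \<in> X" using A' by auto
    note ix = i[OF xX]
    \<comment> \<open>At a fixed point the second intertwining equation conjugates one label into
      the other, so trivial labels correspond to trivial labels.\<close>
    have "snd g' (snd h x) \<noteq> snd h x \<or> fst g' (snd h x) \<noteq> \<one>\<^bsub>H\<^esub>"
    proof (rule ccontr)
      assume c: "\<not> (snd g' (snd h x) \<noteq> snd h x \<or> fst g' (snd h x) \<noteq> \<one>\<^bsub>H\<^esub>)"
      then have "snd g x = x" using ix inj by (auto simp: intertwines_def inj_def)
      moreover have "fst h (snd h x) \<in> carrier H" "fst g x \<in> carrier H"
        using xX by (auto simp: fst_W_closed snd_W_closed g h)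
      moreover have "fst h (snd h x) \<otimes>\<^bsub>H\<^esub> fst g x = \<one>\<^bsub>H\<^esub> \<otimes>\<^bsub>H\<^esub> fst h (snd h x)"
        using ix c calculation by (auto simp: intertwines_def)
      ultimately have "fst g x = \<one>\<^bsub>H\<^esub>" by simp
      then show False using x \<open>snd g x = x\<close> by blast
    qed
    then show ?thesis using x by blast
  qed
  ultimately show "snd h ` A \<in> cycles_of H X g'" "cycle_class H g' (snd h ` A) = cycle_class H g A"
    using sub by (auto simp: cycles_of_def)
qed

lemma cycle_type_conj:
  assumes g: "g \<in> carrier W" and g': "g' \<in> carrier W" and h: "h \<in> carrier W"
    and e: "h \<otimes>\<^bsub>W\<^esub> g = g' \<otimes>\<^bsub>W\<^esub> h"
  shows "cycle_type H X g = cycle_type H X g'"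
proof -
  define k where "k = inv\<^bsub>W\<^esub> h"
  have k: "k \<in> carrier W" "k \<otimes>\<^bsub>W\<^esub> g' = g \<otimes>\<^bsub>W\<^esub> k" "h \<otimes>\<^bsub>W\<^esub> k = \<one>\<^bsub>W\<^esub>"
  proof -
    show "k \<in> carrier W" "h \<otimes>\<^bsub>W\<^esub> k = \<one>\<^bsub>W\<^esub>" using h by (auto simp: k_def)
    have "g \<otimes>\<^bsub>W\<^esub> k = k \<otimes>\<^bsub>W\<^esub> (h \<otimes>\<^bsub>W\<^esub> g) \<otimes>\<^bsub>W\<^esub> k"
      using g h by (simp add: k_def W.m_assoc[symmetric])
    also have "\<dots> = k \<otimes>\<^bsub>W\<^esub> g'" unfolding e using g' h by (simp add: k_def W.m_assoc)
    finally show "k \<otimes>\<^bsub>W\<^esub> g' = g \<otimes>\<^bsub>W\<^esub> k" ..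
  qed
  have hk: "snd h (snd k x) = x" for x using arg_cong[OF k(3), of "\<lambda>u. snd u x"] by simp
  have inj: "inj (snd h)" using h by (auto simp: mem_carrier_W permutes_inj)
  have b: "bij_betw ((`) (snd h)) (cycles_of H X g) (cycles_of H X g')"
  proof (rule bij_betw_imageI)
    show "inj_on ((`) (snd h)) (cycles_of H X g)" using inj by (simp add: inj_on_def inj_image_eq_iff)
    have "A \<in> (`) (snd h) ` cycles_of H X g" if "A \<in> cycles_of H X g'" for A
    proof -
      have "A = snd h ` snd k ` A" by (simp add: image_image hk)
      then show ?thesis using cycles_of_conj(1)[OF g' g k(1,2) that] by blast
    qed
    then show "(`) (snd h) ` cycles_of H X g = cycles_of H X g'"
      using cycles_of_conj(1)[OF g g' h e] by blast
  qed
  have "cycle_type H X g' = image_mset (cycle_class H g') (image_mset ((`) (snd h)) (mset_set (cycles_of H X g)))"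
    using b by (simp add: cycle_type_def bij_betw_def image_mset_mset_set)
  also have "\<dots> = cycle_type H X g"
    unfolding cycle_type_def multiset.map_comp
    by (rule image_mset_cong) (use cycles_of_conj(2)[OF g g' h e] finite_cycles_of[OF g] in auto)
  finally show ?thesis ..
qed

text \<open>Once base points \<open>x\<close>, \<open>y\<close> and the value \<open>a\<close> of
  \<eta> at \<open>x\<close> are chosen, the equations along the cycle force \<eta> at the i-th
  point to be \<open>Q i\<close> times \<open>a\<close> times the inverse of \<open>P i\<close>. The
  only condition left is that the values match after one round, that is, that \<open>a\<close>
  conjugates the two cycle products.\<close>

lemma intertwines_cycles:
  assumes g: "g \<in> carrier W" and g': "g' \<in> carrier W"
    and A: "A \<in> cycles_of H X g" and B: "B \<in> cycles_of H X g'"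
    and eq: "cycle_class H g A = cycle_class H g' B"
  shows "\<exists>\<sigma> \<eta>. bij_betw \<sigma> A B \<and> (\<forall>z\<in>A. \<eta> z \<in> carrier H \<and> intertwines H g g' \<sigma> \<eta> z)"
proof -
  note A' = cycles_ofD[OF A] and B' = cycles_ofD[OF B]
  obtain x y where x: "x \<in> A" and y: "y \<in> B" using A'(4) B'(4) by blast
  have xX: "x \<in> X" "y \<in> X" using x y A'(1) B'(1) by auto
  define P where "P n = cycle_product H g n x" for n
  define Q where "Q n = cycle_product H g' n y" for n
  have cl: "P n \<in> carrier H" "Q n \<in> carrier H" for n
    unfolding P_def Q_def using xX by (auto intro: cycle_product_closed g g')
  have pos: "0 < card A" "0 < card B" using A' B' by (auto simp: card_gt_0_iff)
  have e1: "conj_class H (P (card A)) = conj_class H (Q (card B))"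
    and e2: "(if P (card A) = \<one>\<^bsub>H\<^esub> then card A - 1 else card A) = (if Q (card B) = \<one>\<^bsub>H\<^esub> then card B - 1 else card B)"
    using eq cycle_class_eq[OF g A'(1,2) x] cycle_class_eq[OF g' B'(1,2) y] by (auto simp: P_def Q_def)
  have "P (card A) = \<one>\<^bsub>H\<^esub> \<longleftrightarrow> Q (card B) = \<one>\<^bsub>H\<^esub>"
    using e1 H.conj_class_eq_one_iff[OF cl(1)] H.conj_class_eq_one_iff[OF cl(2)] by metis
  \<comment> \<open>Conjugate products are trivial simultaneously, so both costs are computed by the
    same rule; nonempty cycles make the truncated subtraction harmless.\<close>
  then have k: "card B = card A" using e2 pos by (auto split: if_splits)
  define k where "k = card A"
  obtain a where a: "a \<in> carrier H" "a \<otimes>\<^bsub>H\<^esub> P k = Q k \<otimes>\<^bsub>H\<^esub> a"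
    using e1 H.conj_class_eq_iff[OF cl] by (auto simp: k_def k)
  define F where "F i = (snd g ^^ i) x" for i
  define G where "G i = (snd g' ^^ i) y" for i
  have bF: "bij_betw F {..<k} A" and bG: "bij_betw G {..<k} B"
    using bij_betw_cyclic_on[OF A'(2) x] bij_betw_cyclic_on[OF B'(2) y] by (auto simp: F_def[abs_def] G_def[abs_def] k_def k)
  have kk: "F k = F 0" "G k = G 0"
    using funpow_card_cyclic_on[OF A'(2) x] funpow_card_cyclic_on[OF B'(2) y] by (auto simp: F_def G_def k_def k)
  define ix where "ix = the_inv_into {..<k} F"
  have ix: "ix (F i) = i" if "i < k" for i
    unfolding ix_def using that bF by (auto simp: bij_betw_def intro: the_inv_into_f_f)
  define \<sigma> where "\<sigma> z = G (ix z)" for z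
  define \<eta> where "\<eta> z = Q (ix z) \<otimes>\<^bsub>H\<^esub> a \<otimes>\<^bsub>H\<^esub> inv\<^bsub>H\<^esub> P (ix z)" for z
  have s: "\<sigma> (F i) = G i" if "i \<le> k" for i
    using that ix[of i] ix[of 0] kk pos by (cases "i = k") (auto simp: \<sigma>_def k_def)
  \<comment> \<open>At \<open>i = k\<close> the cycle closes: \<open>F k = F 0\<close>, and the
    formula returns the value \<open>a\<close> found at \<open>F 0\<close> because \<open>a\<close>
    conjugates the products.\<close>
  have h: "\<eta> (F i) = Q i \<otimes>\<^bsub>H\<^esub> a \<otimes>\<^bsub>H\<^esub> inv\<^bsub>H\<^esub> P i" if "i \<le> k" for i
  proof (cases "i = k")
    case True
    have "Q k \<otimes>\<^bsub>H\<^esub> a \<otimes>\<^bsub>H\<^esub> inv\<^bsub>H\<^esub> P k = a"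
      using a cl by (metis H.inv_solve_right H.m_closed)
    moreover have "\<eta> (F 0) = a"
      using ix[of 0] pos a by (simp add: \<eta>_def k_def P_def Q_def)
    ultimately show ?thesis using True kk by simp
  qed (use that ix in \<open>auto simp: \<eta>_def\<close>)
  have "bij_betw (\<sigma> \<circ> F) {..<k} B"
    using bG s by (subst bij_betw_cong[of _ _ G]) auto
  then have "bij_betw \<sigma> A B" using bij_betw_comp_iff[OF bF] by blast
  moreover have "\<eta> z \<in> carrier H \<and> intertwines H g g' \<sigma> \<eta> z" if z: "z \<in> A" for z
  proof -
    obtain i where i: "i < k" "z = F i"
      using z bij_betw_imp_surj_on[OF bF] by blast
    have FS: "snd g (F i) = F (Suc i)" "snd g' (G i) = G (Suc i)" by (auto simp: F_def G_def)
    have FX: "F (Suc i) \<in> X" "G (Suc i) \<in> X"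
      unfolding F_def G_def using xX funpow_W_closed[OF g] funpow_W_closed[OF g'] by blast+
    have PS: "P (Suc i) = fst g (F (Suc i)) \<otimes>\<^bsub>H\<^esub> P i" "Q (Suc i) = fst g' (G (Suc i)) \<otimes>\<^bsub>H\<^esub> Q i"
      by (auto simp: P_def Q_def F_def G_def)
    have c: "fst g (F (Suc i)) \<in> carrier H" "fst g' (G (Suc i)) \<in> carrier H"
      using FX by (auto intro: fst_W_closed g g')
    have "\<eta> (F (Suc i)) \<otimes>\<^bsub>H\<^esub> fst g (F (Suc i)) = fst g' (G (Suc i)) \<otimes>\<^bsub>H\<^esub> \<eta> (F i)"
      using i cl a(1) c by (simp add: h PS(1) PS(2) H.inv_mult_group H.m_assoc)
    then have "intertwines H g g' \<sigma> \<eta> z"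
      unfolding intertwines_def i(2) FS using i by (simp add: s FS)
    moreover have "\<eta> z \<in> carrier H" using i cl a(1) by (simp add: h)
    ultimately show ?thesis by blast
  qed
  ultimately show ?thesis by blast
qed

end

section \<open>From equal cycle types to conjugacy\<close>

lemma image_mset_mset_set_eq_imp_bij:
  assumes "finite A" "finite B" "image_mset f (mset_set A) = image_mset g (mset_set B)"
  shows "\<exists>\<beta>. bij_betw \<beta> A B \<and> (\<forall>a\<in>A. g (\<beta> a) = f a)"
  using assms
proof (induction A arbitrary: B rule: finite_induct)
  case empty
  then have "B = {}" by (simp add: mset_set_empty_iff)
  then show ?case by (auto simp: bij_betw_def)
next
  case (insert a A)
  have "f a \<in># image_mset g (mset_set B)" using insert.hyps insert.prems(2)[symmetric] by simp
  then obtain b where b: "b \<in> B" "g b = f a" using insert.prems(1) by auto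
  have "mset_set B = add_mset b (mset_set (B - {b}))"
    using b insert.prems(1) by (metis finite_Diff insert_Diff Diff_iff insertI1 mset_set.insert)
  then have "image_mset f (mset_set A) = image_mset g (mset_set (B - {b}))"
    using insert b by simp
  then obtain \<beta> where \<beta>: "bij_betw \<beta> A (B - {b})" "\<forall>x\<in>A. g (\<beta> x) = f x"
    using insert.IH[of "B - {b}"] insert.prems(1) by auto
  let ?\<beta> = "\<beta>(a := b)"
  have "bij_betw ?\<beta> A (B - {b})"
    using \<beta>(1) insert.hyps(2) by (subst bij_betw_cong[of _ _ \<beta>]) auto
  then have "bij_betw ?\<beta> (A \<union> {a}) ((B - {b}) \<union> {b})"
    by (rule bij_betw_combine) auto
  then have "bij_betw ?\<beta> (insert a A) B" using b by (simp add: insert_absorb)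
  moreover have "\<forall>x\<in>insert a A. g (?\<beta> x) = f x" using \<beta>(2) b insert.hyps by auto
  ultimately show ?case by blast
qed

text \<open>Inside the finite set \<open>A \<union> B\<close> the complements of \<open>A\<close>
  and \<open>B\<close> have the same size. Any bijection between them completes \<sigma> to a
  permutation of this set, and all other points are fixed.\<close>

lemma bij_betw_extends_to_permutation:
  assumes "bij_betw \<sigma> A B" "finite A" "A \<subseteq> X" "B \<subseteq> X"
  shows "\<exists>\<tau>. \<tau> permutes X \<and> finite {x. \<tau> x \<noteq> x} \<and> (\<forall>a\<in>A. \<tau> a = \<sigma> a)"
proof -
  define Z where "Z = A \<union> B"
  have fin: "finite Z" "finite B" using assms bij_betw_finite[OF assms(1)] by (auto simp: Z_def)
  have "card (Z - A) = card (Z - B)"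
    using assms fin bij_betw_same_card[OF assms(1)] by (simp add: Z_def card_Diff_subset)
  then obtain \<rho> where \<rho>: "bij_betw \<rho> (Z - A) (Z - B)"
    using fin by (metis finite_Diff finite_same_card_bij)
  define \<tau> where "\<tau> x = (if x \<in> A then \<sigma> x else if x \<in> Z then \<rho> x else x)" for x
  have "bij_betw \<tau> A B" using assms(1) by (rule bij_betw_cong[THEN iffD1, rotated]) (simp add: \<tau>_def)
  moreover have "bij_betw \<tau> (Z - A) (Z - B)"
    using \<rho> by (rule bij_betw_cong[THEN iffD1, rotated]) (simp add: \<tau>_def)
  ultimately have "bij_betw \<tau> (A \<union> (Z - A)) (B \<union> (Z - B))"
    by (rule bij_betw_combine) auto
  then have "bij_betw \<tau> Z Z" by (simp add: Z_def Un_absorb1 Un_commute)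
  then have p: "\<tau> permutes Z" by (rule bij_imp_permutes) (auto simp: \<tau>_def Z_def)
  then have "\<tau> permutes X" by (rule permutes_subset) (use assms in \<open>auto simp: Z_def\<close>)
  moreover have "finite {x. \<tau> x \<noteq> x}"
    by (rule finite_subset[OF _ fin(1)]) (auto simp: \<tau>_def Z_def)
  ultimately show ?thesis by (auto simp: \<tau>_def)
qed

context wreath_product
begin

text \<open>Cycles with equal classes are matched, and the local solutions of
  \<open>intertwines_cycles\<close> are glued, which is possible because cycles are disjoint. On the
  remaining points both elements are trivial, so any permutation with \<eta> = 1 intertwines them
  there.\<close>

lemma cycle_type_eq_imp_conj:
  assumes g: "g \<in> carrier W" and g': "g' \<in> carrier W"
    and eq: "cycle_type H X g = cycle_type H X g'"
  shows "\<exists>h\<in>carrier W. h \<otimes>\<^bsub>W\<^esub> g = g' \<otimes>\<^bsub>W\<^esub> h"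
proof -
  define C where "C = cycles_of H X g"
  define C' where "C' = cycles_of H X g'"
  obtain \<beta> where \<beta>: "bij_betw \<beta> C C'" "\<And>A. A \<in> C \<Longrightarrow> cycle_class H g' (\<beta> A) = cycle_class H g A"
    using image_mset_mset_set_eq_imp_bij[OF finite_cycles_of[OF g] finite_cycles_of[OF g'] eq[unfolded cycle_type_def]]
    by (auto simp: C_def C'_def)
  have "\<exists>\<sigma> \<eta>. bij_betw \<sigma> A (\<beta> A) \<and> (\<forall>z\<in>A. \<eta> z \<in> carrier H \<and> intertwines H g g' \<sigma> \<eta> z)" if "A \<in> C" for A
    using intertwines_cycles[OF g g', of A "\<beta> A"] that \<beta>(2)[OF that] bij_betwE[OF \<beta>(1)] by (simp add: C_def C'_def)
  then obtain s e where se: "\<And>A. A \<in> C \<Longrightarrow> bij_betw (s A) A (\<beta> A)"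
    "\<And>A z. A \<in> C \<Longrightarrow> z \<in> A \<Longrightarrow> e A z \<in> carrier H \<and> intertwines H g g' (s A) (e A) z"
    by metis
  have disj: "A = B" if "A \<in> C" "B \<in> C" "z \<in> A" "z \<in> B" for A B z
    using that cyclic_on_disjoint[of "snd g" A B] by (auto simp: C_def cycles_of_def)
  have disj': "A = B" if "A \<in> C'" "B \<in> C'" "z \<in> A" "z \<in> B" for A B z
    using that cyclic_on_disjoint[of "snd g'" A B] by (auto simp: C'_def cycles_of_def)
  define cyc where "cyc z = (THE A. A \<in> C \<and> z \<in> A)" for z
  have cyc: "cyc z = A" if "A \<in> C" "z \<in> A" for A z
    unfolding cyc_def using that disj by (intro the_equality) auto
  define \<sigma> where "\<sigma> z = s (cyc z) z" for z
  have \<sigma>: "\<sigma> z = s A z" if "A \<in> C" "z \<in> A" for A z using cyc[OF that] by (simp add: \<sigma>_def)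
  have b: "bij_betw \<sigma> (\<Union>C) (\<Union>C')"
  proof (rule bij_betw_imageI)
    show "inj_on \<sigma> (\<Union>C)"
    proof (rule inj_onI)
      fix x y assume "x \<in> \<Union>C" "y \<in> \<Union>C" and e: "\<sigma> x = \<sigma> y"
      then obtain A B where A: "A \<in> C" "x \<in> A" and B: "B \<in> C" "y \<in> B" by blast
      have m: "\<sigma> x \<in> \<beta> A" "\<sigma> y \<in> \<beta> B"
        using se(1) A B \<sigma> by (auto simp: bij_betw_def)
      have "\<beta> A = \<beta> B"
        using disj'[of "\<beta> A" "\<beta> B" "\<sigma> x"] m e \<beta>(1) A B by (auto simp: bij_betw_def)
      then have "A = B" using \<beta>(1) A B by (auto simp: bij_betw_def inj_on_def)
      then show "x = y" using e \<sigma> A B se(1)[OF A(1)] by (auto simp: bij_betw_def inj_on_def)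
    qed
    have "\<sigma> ` A = \<beta> A" if "A \<in> C" for A
      using se(1)[OF that] \<sigma>[OF that] by (auto simp: bij_betw_def cong: image_cong)
    then have "(\<Union>A\<in>C. \<sigma> ` A) = (\<Union>A\<in>C. \<beta> A)" by simp
    then show "\<sigma> ` \<Union>C = \<Union>C'" using \<beta>(1) by (simp add: bij_betw_def image_Union)
  qed
  have sub: "\<Union>C \<subseteq> X" "\<Union>C' \<subseteq> X" "finite (\<Union>C)"
    using cycles_ofD(1) cycles_ofD(3) finite_cycles_of[OF g] unfolding C_def C'_def by blast+
  obtain \<tau> where \<tau>: "\<tau> permutes X" "finite {x. \<tau> x \<noteq> x}" "\<And>a. a \<in> \<Union>C \<Longrightarrow> \<tau> a = \<sigma> a"
    using bij_betw_extends_to_permutation[OF b sub(3,1,2)] by blast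
  define \<eta> where "\<eta> z = (if z \<in> \<Union>C then e (cyc z) z else \<one>\<^bsub>H\<^esub>)" for z
  have \<eta>: "\<eta> z = e A z" if "A \<in> C" "z \<in> A" for A z using cyc[OF that] that by (auto simp: \<eta>_def)
  have \<eta>c: "\<eta> z \<in> carrier H" for z
  proof (cases "z \<in> \<Union>C")
    case True
    then obtain A where A: "A \<in> C" "z \<in> A" by blast
    then show ?thesis using se(2)[OF A] \<eta>[OF A] by simp
  qed (simp add: \<eta>_def)
  \<comment> \<open>In \<open>intertwines\<close> the base function \<psi> enters as \<eta> = \<psi>
    \<circ> \<tau>, so \<psi> is \<eta> composed with the inverse of \<tau>.\<close>
  define h where "h = ((\<lambda>x\<in>X. \<eta> (Hilbert_Choice.inv \<tau> x)), \<tau>)"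
  have fh: "fst h (\<tau> z) = \<eta> z" if "z \<in> X" for z
    using that by (auto simp: h_def permutes_in_image[OF \<tau>(1)] permutes_inverses[OF \<tau>(1)])
  have sh: "snd h = \<tau>" by (simp add: h_def)
  have "{x \<in> X. fst h x \<noteq> \<one>\<^bsub>H\<^esub>} \<subseteq> \<tau> ` (\<Union>C)"
  proof
    fix x assume "x \<in> {x \<in> X. fst h x \<noteq> \<one>\<^bsub>H\<^esub>}"
    then have "Hilbert_Choice.inv \<tau> x \<in> \<Union>C" by (auto simp: h_def \<eta>_def split: if_splits)
    then show "x \<in> \<tau> ` (\<Union>C)" using permutes_inverses(1)[OF \<tau>(1), of x] by (metis imageI)
  qed
  then have "finite {x \<in> X. fst h x \<noteq> \<one>\<^bsub>H\<^esub>}" using sub(3) by (rule finite_subset[OF _ finite_imageI])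
  then have h: "h \<in> carrier W"
    using \<tau> \<eta>c by (auto simp: mem_carrier_W h_def)
  have "intertwines H g g' (snd h) (\<lambda>z. fst h (snd h z)) z" if z: "z \<in> X" for z
  proof (cases "z \<in> \<Union>C")
    case True
    then obtain A where A: "A \<in> C" "z \<in> A" by blast
    have gz: "snd g z \<in> A" using A cyclic_on_inI by (auto simp: C_def cycles_of_def)
    have "intertwines H g g' (s A) (e A) z" using se(2) A by blast
    then show ?thesis
      using A(1) fh[OF z] fh[of "snd g z"] z snd_W_closed[OF g, of z]
        \<tau>(3)[OF UnionI[OF A]] \<tau>(3)[OF UnionI[OF A(1) gz]] \<sigma>[OF A] \<sigma>[OF A(1) gz] \<eta>[OF A] \<eta>[OF A(1) gz]
      by (simp add: intertwines_def sh)
  next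
    case False
    then have 1: "snd g z = z" "fst g z = \<one>\<^bsub>H\<^esub>"
      using mem_Union_cycles_of_iff[OF g, of z] z by (auto simp: C_def)
    \<comment> \<open>The cycles of \<open>g\<close> already cover those of \<open>g'\<close> under
      \<tau>, so by injectivity a point outside the former cannot land in the latter.\<close>
    have "\<tau> z \<notin> \<Union>C'"
    proof
      assume "\<tau> z \<in> \<Union>C'"
      then obtain y where "y \<in> \<Union>C" "\<tau> z = \<tau> y" using bij_betw_imp_surj_on[OF b] \<tau>(3) by (metis imageE)
      then show False using False permutes_inj[OF \<tau>(1)] by (auto simp: inj_def)
    qed
    then have 2: "snd g' (\<tau> z) = \<tau> z" "fst g' (\<tau> z) = \<one>\<^bsub>H\<^esub>"
      using mem_Union_cycles_of_iff[OF g', of "\<tau> z"] z permutes_in_image[OF \<tau>(1)] by (auto simp: C'_def)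
    show ?thesis using 1 2 z fh \<eta>c by (simp add: intertwines_def sh)
  qed
  then show ?thesis using intertwines_iff[OF g g' h] h by blast
qed

lemma conj_class_W_eq_iff:
  assumes "g \<in> carrier W" "g' \<in> carrier W"
  shows "conj_class W g = conj_class W g' \<longleftrightarrow> cycle_type H X g = cycle_type H X g'"
  using W.conj_class_eq_iff[OF assms] cycle_type_conj[OF assms] cycle_type_eq_imp_conj[OF assms] by blast

end

section \<open>Word length and conjugacy length\<close>

abbreviation (input) word_product :: "('a, 'b) monoid_scheme \<Rightarrow> 'a list \<Rightarrow> 'a" where
  "word_product G ws \<equiv> foldr (\<lambda>x y. x \<otimes>\<^bsub>G\<^esub> y) ws \<one>\<^bsub>G\<^esub>"

context group
begin

lemma word_product_closed: "set ws \<subseteq> carrier G \<Longrightarrow> word_product G ws \<in> carrier G"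
  by (induction ws) auto

lemma word_product_append:
  "set us \<subseteq> carrier G \<Longrightarrow> set vs \<subseteq> carrier G \<Longrightarrow>
   word_product G (us @ vs) = word_product G us \<otimes> word_product G vs"
  by (induction us) (auto simp: m_assoc word_product_closed)

text \<open>Ensures that \<open>word_length\<close> takes its minimum over a nonempty set.\<close>

lemma generate_imp_word:
  assumes "S \<subseteq> carrier G" "g \<in> generate G S"
  shows "\<exists>ws. set ws \<subseteq> S \<union> m_inv G ` S \<and> g = word_product G ws"
  using assms(2)
proof induction
  case one
  show ?case by (rule exI[of _ "[]"]) simp
next
  case (incl h)
  then show ?case using assms(1) by (intro exI[of _ "[h]"]) auto
next
  case (inv h)
  then show ?case using assms(1) by (intro exI[of _ "[inv h]"]) auto
next
  case (eng h1 h2)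
  then obtain us vs where "set us \<subseteq> S \<union> m_inv G ` S" "h1 = word_product G us"
    "set vs \<subseteq> S \<union> m_inv G ` S" "h2 = word_product G vs" by blast
  moreover have S: "S \<union> m_inv G ` S \<subseteq> carrier G" using assms(1) by auto
  ultimately have "set (us @ vs) \<subseteq> S \<union> m_inv G ` S" "h1 \<otimes> h2 = word_product G (us @ vs)"
    using word_product_append[of us vs] order_trans[OF _ S] by simp_all
  then show ?case by blast
qed

end

section \<open>The letters and their inverses\<close>

context wreath_product
begin

lemma single_elt_closed:
  assumes "u \<in> X" "a \<in> carrier H"
  shows "single_elt H X u a \<in> carrier W"
proof -
  have "finite {x \<in> X. fst (single_elt H X u a) x \<noteq> \<one>\<^bsub>H\<^esub>}"
    by (rule finite_subset[of _ "{u}"]) (auto simp: single_elt_def)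
  then show ?thesis using assms by (auto simp: mem_carrier_W single_elt_def permutes_id)
qed

lemma snd_single_elt [simp]: "snd (single_elt H X u a) = id"
  and fst_single_elt: "x \<in> X \<Longrightarrow> fst (single_elt H X u a) x = (if x = u then a else \<one>\<^bsub>H\<^esub>)"
  by (simp_all add: single_elt_def)

lemma transp_elt_closed:
  assumes "u \<in> X" "v \<in> X"
  shows "transp_elt H X u v \<in> carrier W"
proof -
  have "finite {x. Transposition.transpose u v x \<noteq> x}"
    by (rule finite_subset[of _ "{u, v}"]) (auto simp: Transposition.transpose_def)
  then show ?thesis using assms by (auto simp: mem_carrier_W transp_elt_def permutes_swap_id)
qed

lemma snd_transp_elt [simp]: "snd (transp_elt H X u v) = Transposition.transpose u v"
  and fst_transp_elt: "x \<in> X \<Longrightarrow> fst (transp_elt H X u v) x = \<one>\<^bsub>H\<^esub>"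
  by (simp_all add: transp_elt_def)

lemma T_closed: "T_H H X \<union> T_X H X \<subseteq> carrier W"
  by (auto simp: T_H_def T_X_def single_elt_closed transp_elt_closed)

lemma inv_single_elt:
  assumes "u \<in> X" "a \<in> carrier H"
  shows "inv\<^bsub>W\<^esub> single_elt H X u a = single_elt H X u (inv\<^bsub>H\<^esub> a)"
proof (rule W.inv_equality)
  show "single_elt H X u (inv\<^bsub>H\<^esub> a) \<otimes>\<^bsub>W\<^esub> single_elt H X u a = \<one>\<^bsub>W\<^esub>"
  proof (rule W_eqI)
    fix x assume x: "x \<in> X"
    show "fst (single_elt H X u (inv\<^bsub>H\<^esub> a) \<otimes>\<^bsub>W\<^esub> single_elt H X u a) x = fst \<one>\<^bsub>W\<^esub> x"
      using fst_W_mult[OF single_elt_closed[of u "inv\<^bsub>H\<^esub> a"] x, of "single_elt H X u a"] assms x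
      by (simp add: fst_single_elt fst_W_one)
  qed (use assms in \<open>auto intro: single_elt_closed\<close>)
qed (use assms in \<open>auto intro: single_elt_closed\<close>)

lemma inv_transp_elt:
  assumes "u \<in> X" "v \<in> X"
  shows "inv\<^bsub>W\<^esub> transp_elt H X u v = transp_elt H X u v"
proof (rule W.inv_equality)
  note c = transp_elt_closed[OF assms]
  show "transp_elt H X u v \<otimes>\<^bsub>W\<^esub> transp_elt H X u v = \<one>\<^bsub>W\<^esub>"
  proof (rule W_eqI)
    fix x assume x: "x \<in> X"
    define y where "y = Transposition.transpose u v x"
    have y: "y \<in> X" "x = Transposition.transpose u v y" using x assms by (auto simp: y_def Transposition.transpose_def)
    show "fst (transp_elt H X u v \<otimes>\<^bsub>W\<^esub> transp_elt H X u v) x = fst \<one>\<^bsub>W\<^esub> x"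
      using fst_W_mult[OF c y(1), of "transp_elt H X u v"] x y
      by (simp add: fst_transp_elt fst_W_one)
  qed (use c in auto)
qed (use transp_elt_closed assms in auto)

text \<open>The lower bound is proved for words over all of \<open>T_H\<close> and
  \<open>T_X\<close>; this alphabet also contains the inverse letters allowed by
  \<open>word_length\<close>.\<close>

lemma T_inv_closed: "m_inv W ` (T_H H X \<union> T_X H X) \<subseteq> T_H H X \<union> T_X H X"
proof -
  have "inv\<^bsub>W\<^esub> s \<in> T_H H X" if "s \<in> T_H H X" for s
    using that inv_single_elt by (fastforce simp: T_H_def)
  moreover have "inv\<^bsub>W\<^esub> s \<in> T_X H X" if "s \<in> T_X H X" for s
    using that inv_transp_elt by (fastforce simp: T_X_def)
  ultimately show ?thesis by blast
qed

section \<open>Lower bound for the word length\<close>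

text \<open>
  The map \<open>r\<close> sends a point to a representative of its component, with \<open>None\<close> as the representative of
  the component of the ghost point.
\<close>

lemma ex_component_map:
  assumes "set ws \<subseteq> T_H H X \<union> T_X H X"
  defines "g \<equiv> word_product W ws"
  shows "\<exists>r :: 'x \<Rightarrow> 'x option. finite {x. r x \<noteq> Some x} \<and> card {x. r x \<noteq> Some x} \<le> length ws \<and>
    (\<forall>x. r (snd g x) = r x) \<and> (\<forall>x\<in>X. r x \<noteq> None \<longrightarrow> fst g x = \<one>\<^bsub>H\<^esub>)"
  using assms(1) unfolding g_def
proof (induction ws)
  case Nil
  show ?case by (rule exI[of _ Some]) (auto simp: fst_W_one)
next
  case (Cons s ws)
  define g where "g = word_product W ws"
  have g: "g \<in> carrier W"
    unfolding g_def using Cons.prems T_closed by (intro W.word_product_closed) auto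
  obtain r where r: "finite {x. r x \<noteq> Some x}" "card {x. r x \<noteq> Some x} \<le> length ws"
    "\<And>x. r (snd g x) = r x" "\<And>x. x \<in> X \<Longrightarrow> r x \<noteq> None \<Longrightarrow> fst g x = \<one>\<^bsub>H\<^esub>"
    using Cons unfolding g_def by auto
  \<comment> \<open>\<open>q p\<close> renames the component \<open>snd p\<close> to
    \<open>fst p\<close> and so merges the two. At most one point stops representing itself, namely
    the old representative \<open>the (snd p)\<close>.\<close>
  define q where "q p x = (if r x = snd p then fst p else r x)" for p x
  have card_q: "finite {x. q p x \<noteq> Some x} \<and> card {x. q p x \<noteq> Some x} \<le> length (s # ws)" for p
  proof -
    have "{x. q p x \<noteq> Some x} \<subseteq> insert (the (snd p)) {x. r x \<noteq> Some x}"
      by (auto simp: q_def split: if_splits)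
    moreover have "card (insert (the (snd p)) {x. r x \<noteq> Some x}) \<le> length (s # ws)"
      using r(1,2) by (simp add: card_insert_if)
    ultimately show ?thesis
      using r(1) by (meson card_mono finite.insertI finite_subset le_trans)
  qed
  have "s \<in> T_H H X \<or> s \<in> T_X H X" using Cons.prems by auto
  then show ?case
  proof
    assume "s \<in> T_H H X"
    then obtain u a where s: "s = single_elt H X u a" "u \<in> X" "a \<in> carrier H" by (auto simp: T_H_def)
    have sW: "s \<in> carrier W" using s single_elt_closed by auto
    have "fst (s \<otimes>\<^bsub>W\<^esub> g) x = \<one>\<^bsub>H\<^esub>" if "x \<in> X" "q (None, r u) x \<noteq> None" for x
      using fst_W_mult[OF sW that(1), of g] that r(4)[of x]
      by (auto simp: s(1) fst_single_elt q_def split: if_splits)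
    moreover have "q (None, r u) (snd (s \<otimes>\<^bsub>W\<^esub> g) x) = q (None, r u) x" for x
      by (simp add: s(1) q_def r(3))
    ultimately show ?thesis
      using card_q[of "(None, r u)"] by (intro exI[of _ "q (None, r u)"]) (simp add: g_def)
  next
    assume "s \<in> T_X H X"
    then obtain a b where s: "s = transp_elt H X a b" "a \<in> X" "b \<in> X" by (auto simp: T_X_def)
    have sW: "s \<in> carrier W" using s transp_elt_closed by auto
    \<comment> \<open>The ghost component must keep its name \<open>None\<close>. If
      \<open>b\<close> lies in it, the component of \<open>a\<close> is renamed; otherwise the
      component of \<open>b\<close> is, and its new name may be \<open>None\<close>.\<close>
    define p where "p = (if r b = None then (None, r a) else (r a, r b))"
    have p: "q p a = q p b" "r x = None \<Longrightarrow> q p x = None" for x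
      by (auto simp: q_def p_def)
    have qt: "q p (Transposition.transpose a b x) = q p x" for x
      using p(1) by (auto simp: Transposition.transpose_def)
    have "fst (s \<otimes>\<^bsub>W\<^esub> g) x = \<one>\<^bsub>H\<^esub>" if x: "x \<in> X" "q p x \<noteq> None" for x
    proof -
      define y where "y = Transposition.transpose a b x"
      have y: "y \<in> X" "x = Transposition.transpose a b y" using x(1) s by (auto simp: y_def Transposition.transpose_def)
      have "r y \<noteq> None" using x(2) p(2)[of y] qt[of x] unfolding y_def by metis
      then show ?thesis
        using fst_W_mult[OF sW y(1), of g] r(4)[OF y(1)] x(1) y(2) by (simp add: s(1) fst_transp_elt)
    qed
    moreover have "q p (snd (s \<otimes>\<^bsub>W\<^esub> g) x) = q p x" for x
      by (simp add: s(1) qt) (simp add: q_def r(3))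
    ultimately show ?thesis
      using card_q[of p] by (intro exI[of _ "q p"]) (simp add: g_def)
  qed
qed

text \<open>\<open>r\<close> is constant on each cycle. A cycle containing a point that represents
  itself has trivial labels, and all its other points do not represent themselves: they pay the cost
  \<open>card A - 1\<close>. In any other cycle all \<open>card A\<close> points pay. Cycles are
  disjoint, so no point pays twice.\<close>

lemma cycle_type_weight_le_length:
  assumes ws: "set ws \<subseteq> T_H H X \<union> T_X H X" and g: "g = word_product W ws"
  shows "(\<Sum>t\<in>#cycle_type H X g. snd t) \<le> length ws"
proof -
  have gW: "g \<in> carrier W" unfolding g using ws T_closed by (intro W.word_product_closed) auto
  obtain r :: "'x \<Rightarrow> 'x option" where r: "finite {x. r x \<noteq> Some x}" "card {x. r x \<noteq> Some x} \<le> length ws"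
    "\<And>x. r (snd g x) = r x" "\<And>x. x \<in> X \<Longrightarrow> r x \<noteq> None \<Longrightarrow> fst g x = \<one>\<^bsub>H\<^esub>"
    using ex_component_map[OF ws] g by auto
  have le: "snd (cycle_class H g A) \<le> card {x \<in> A. r x \<noteq> Some x}" if A: "A \<in> cycles_of H X g" for A
  proof (cases "\<exists>y\<in>A. r y = Some y")
    case True
    note A' = cycles_ofD[OF A]
    obtain y where y: "y \<in> A" "r y = Some y" using True by blast
    have rn: "r ((snd g ^^ n) y) = Some y" for n by (induction n) (simp_all add: r(3) y)
    have rA: "r x = Some y" if "x \<in> A" for x
    proof -
      obtain i where "x = (snd g ^^ i) y"
        using bij_betw_imp_surj_on[OF bij_betw_cyclic_on[OF A'(2) y(1)]] \<open>x \<in> A\<close> by blast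
      then show ?thesis using rn by simp
    qed
    have "cycle_product H g n y = \<one>\<^bsub>H\<^esub>" for n
    proof (induction n)
      case (Suc n)
      have "(snd g ^^ Suc n) y \<in> A" by (rule cyclic_on_funpow_in[OF A'(2) y(1)])
      then have "fst g ((snd g ^^ Suc n) y) = \<one>\<^bsub>H\<^esub>" using rA A'(1) by (intro r(4)) auto
      then show ?case using Suc by simp
    qed simp
    then have "snd (cycle_class H g A) = card A - 1"
      using cycle_class_eq[OF gW A'(1,2) y(1)] by simp
    also have "\<dots> = card (A - {y})" using y A' by simp
    also have "A - {y} = {x \<in> A. r x \<noteq> Some x}" using rA by auto
    finally show ?thesis by simp
  next
    case False
    then have "{x \<in> A. r x \<noteq> Some x} = A" by auto
    then show ?thesis by (simp add: cycle_class_def Let_def)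
  qed
  have "(\<Sum>t\<in>#cycle_type H X g. snd t) = (\<Sum>A\<in>cycles_of H X g. snd (cycle_class H g A))"
    by (simp add: cycle_type_def sum_unfold_sum_mset multiset.map_comp comp_def)
  also have "\<dots> \<le> (\<Sum>A\<in>cycles_of H X g. card {x \<in> A. r x \<noteq> Some x})"
    by (rule sum_mono) (rule le)
  also have "\<dots> = card (\<Union>A\<in>cycles_of H X g. {x \<in> A. r x \<noteq> Some x})"
  proof (rule card_UN_disjoint[symmetric])
    show "finite (cycles_of H X g)" by (rule finite_cycles_of[OF gW])
    show "\<forall>A\<in>cycles_of H X g. finite {x \<in> A. r x \<noteq> Some x}"
      using cycles_ofD(3) by auto
    show "\<forall>A\<in>cycles_of H X g. \<forall>B\<in>cycles_of H X g. A \<noteq> B \<longrightarrow> {x \<in> A. r x \<noteq> Some x} \<inter> {x \<in> B. r x \<noteq> Some x} = {}"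
      using cyclic_on_disjoint cycles_ofD(2) by blast
  qed
  also have "\<dots> \<le> card {x. r x \<noteq> Some x}" by (rule card_mono[OF r(1)]) auto
  also have "\<dots> \<le> length ws" by (rule r(2))
  finally show ?thesis .
qed

end

section \<open>Words with prescribed cycles\<close>

lemma cyclic_on_transpose_insert:
  assumes f: "f permutes U" and c: "cyclic_on f U" and u: "u \<in> U" and v: "v \<notin> U"
  shows "cyclic_on (Transposition.transpose u v \<circ> f) (insert v U)"
proof -
  define h where "h = Transposition.transpose u v \<circ> f"
  have fv: "f v = v" using f v by (simp add: permutes_not_in)
  have b: "bij_betw (\<lambda>i. (f ^^ i) u) {..<card U} U" by (rule bij_betw_cyclic_on[OF c u])
  \<comment> \<open>The composition inserts \<open>v\<close> directly before \<open>u\<close>: it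
    sends \<open>v\<close> to \<open>u\<close> and the \<open>f\<close>-preimage of \<open>u\<close>
    to \<open>v\<close>. Started at \<open>v\<close>, it therefore follows the old cycle from
    \<open>u\<close> onwards, one step late.\<close>
  have step: "(h ^^ Suc i) v = (f ^^ i) u" if "i < card U" for i
    using that
  proof (induction i)
    case 0
    then show ?case by (simp add: h_def fv)
  next
    case (Suc i)
    have "(f ^^ Suc i) u \<noteq> (f ^^ 0) u"
      using b Suc.prems inj_onD[of "\<lambda>i. (f ^^ i) u" "{..<card U}" "Suc i" 0] by (auto simp: bij_betw_def)
    moreover have "(f ^^ Suc i) u \<noteq> v" using cyclic_on_funpow_in[OF c u, of "Suc i"] v by metis
    moreover have "(h ^^ Suc (Suc i)) v = Transposition.transpose u v ((f ^^ Suc i) u)"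
    proof -
      have "(h ^^ Suc (Suc i)) v = h ((h ^^ Suc i) v)" by simp
      also have "(h ^^ Suc i) v = (f ^^ i) u" by (rule Suc.IH) (use Suc.prems in simp)
      also have "h ((f ^^ i) u) = Transposition.transpose u v ((f ^^ Suc i) u)" by (simp add: h_def)
      finally show ?thesis .
    qed
    ultimately show ?case by (simp add: Transposition.transpose_def)
  qed
  have pos: "0 < card U" using u finite_cyclic_on[OF c] by (auto simp: card_gt_0_iff)
  have "(h ^^ Suc (card U)) v = v"
  proof -
    have "(h ^^ Suc (card U)) v = h ((h ^^ Suc (card U - 1)) v)" using pos by simp
    also have "\<dots> = h ((f ^^ (card U - 1)) u)" using step[of "card U - 1"] pos by simp
    also have "\<dots> = Transposition.transpose u v ((f ^^ Suc (card U - 1)) u)" by (simp add: h_def)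
    also have "\<dots> = v" using pos funpow_card_cyclic_on[OF c u] by simp
    finally show ?thesis .
  qed
  then have vo: "v \<in> Orbits.orbit h v" unfolding orbit_altdef by (metis (mono_tags, lifting) mem_Collect_eq zero_less_Suc)
  have "x \<in> Orbits.orbit h v" if "x \<in> U" for x
  proof -
    obtain i where "i < card U" "x = (f ^^ i) u"
      using bij_betw_imp_surj_on[OF b] \<open>x \<in> U\<close> by blast
    then have "x = (h ^^ Suc i) v" using step by simp
    then show ?thesis unfolding orbit_altdef by blast
  qed
  moreover have "h permutes insert v U"
    unfolding h_def
    by (intro permutes_compose permutes_subset[OF f] permutes_swap_id) (use u in auto)
  then have "Orbits.orbit h v \<subseteq> insert v U" by (rule permutes_orbit_subset) simp
  ultimately have "insert v U = Orbits.orbit h v" using vo by blast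
  then show ?thesis unfolding h_def[symmetric] by (intro cyclic_on_singleI[of v]) auto
qed

context wreath_product
begin

text \<open>Starting from a single vertex, the support of the cycle grows by one neighbouring vertex
  per letter, so \<open>card V - 1\<close> edges suffice.\<close>

lemma ex_word_cycle:
  assumes V: "finite V" "V \<subseteq> X" "graph_connected V E" and E: "E \<subseteq> transposition_graph H X S" and S: "S \<subseteq> T_X H X"
  shows "\<exists>ws. set ws \<subseteq> S \<and> length ws = card V - 1 \<and>
    snd (word_product W ws) permutes V \<and> cyclic_on (snd (word_product W ws)) V \<and>
    (\<forall>x\<in>X. fst (word_product W ws) x = \<one>\<^bsub>H\<^esub>)"
proof -
  obtain x0 where x0: "x0 \<in> V" using V(3) by (auto simp: graph_connected_def)
  have grow: "\<exists>U\<subseteq>V. x0 \<in> U \<and> card U = Suc n \<and> (\<exists>ws. set ws \<subseteq> S \<and> length ws = n \<and>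
    snd (word_product W ws) permutes U \<and> cyclic_on (snd (word_product W ws)) U \<and>
    (\<forall>x\<in>X. fst (word_product W ws) x = \<one>\<^bsub>H\<^esub>))" if "n < card V" for n
    using that
  proof (induction n)
    case 0
    have "Orbits.orbit id x0 = {x0}" by (simp add: orbit_eq_singleton_iff)
    then have "cyclic_on id {x0}" by (intro cyclic_on_singleI[of x0]) simp_all
    note this[unfolded id_def]
    then show ?case using x0 by (intro exI[of _ "{x0}"] conjI exI[of _ "[]"]) (auto simp: fst_W_one permutes_id)
  next
    case (Suc n)
    then obtain U ws where U: "U \<subseteq> V" "x0 \<in> U" "card U = Suc n" and ws: "set ws \<subseteq> S" "length ws = n"
      "snd (word_product W ws) permutes U" "cyclic_on (snd (word_product W ws)) U"
      "\<And>x. x \<in> X \<Longrightarrow> fst (word_product W ws) x = \<one>\<^bsub>H\<^esub>" by auto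
    have "U \<noteq> V" using U Suc.prems by auto
    then obtain z where z: "z \<in> V" "z \<notin> U" using U by blast
    have "(x0, z) \<in> {(a, b). a \<in> V \<and> b \<in> V \<and> {a, b} \<in> E}\<^sup>*"
      using V(3) x0 z by (auto simp: graph_connected_def)
    \<comment> \<open>A path from a point of \<open>U\<close> to a point outside has an edge that
      leaves \<open>U\<close>.\<close>
    then have "\<exists>u v. u \<in> U \<and> v \<in> V \<and> v \<notin> U \<and> {u, v} \<in> E"
      using z(2)
    proof (induction rule: rtrancl_induct)
      case base
      then show ?case using U by simp
    next
      case (step y z)
      then show ?case by (cases "y \<in> U") auto
    qed
    then obtain u v where uv: "u \<in> U" "v \<in> V" "v \<notin> U" "{u, v} \<in> E" by blast
    then have uX: "u \<in> X" "v \<in> X" using U V by auto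
    have "transp_elt H X u v = transp_elt H X v u" by (simp add: transp_elt_def transpose_commute)
    moreover obtain x y where "{u, v} = {x, y}" "transp_elt H X x y \<in> S"
      using uv(4) E by (auto simp: transposition_graph_def)
    ultimately have s: "transp_elt H X u v \<in> S"
      by (auto simp: doubleton_eq_iff)
    have sW: "transp_elt H X u v \<in> carrier W" by (rule transp_elt_closed[OF uX])
    define g where "g = word_product W ws"
    have "fst (transp_elt H X u v \<otimes>\<^bsub>W\<^esub> g) x = \<one>\<^bsub>H\<^esub>" if x: "x \<in> X" for x
    proof -
      define y where "y = Transposition.transpose u v x"
      have y: "y \<in> X" "x = Transposition.transpose u v y" using x uX by (auto simp: y_def Transposition.transpose_def)
      show ?thesis
        using fst_W_mult[OF sW y(1), of g] ws(5)[OF y(1)] x y(2) by (simp add: fst_transp_elt g_def)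
    qed
    moreover have "cyclic_on (Transposition.transpose u v \<circ> snd g) (insert v U)"
      using cyclic_on_transpose_insert[of "snd g" U u v] ws uv by (simp add: g_def)
    moreover have "(Transposition.transpose u v \<circ> snd g) permutes insert v U"
      using uv by (intro permutes_compose permutes_swap_id permutes_subset[OF ws(3)[folded g_def]]) auto
    moreover have "card (insert v U) = Suc (Suc n)"
      using U uv finite_subset[OF U(1) V(1)] by simp
    ultimately show ?case
      using ws(1,2) s U uv
      by (intro exI[of _ "insert v U"] conjI exI[of _ "transp_elt H X u v # ws"]) (auto simp: g_def[symmetric] comp_def)
  qed
  have pos: "0 < card V" using x0 V(1) by (auto simp: card_gt_0_iff)
  then have "card V - 1 < card V" by simp
  from grow[OF this] obtain U where U: "U \<subseteq> V" "card U = Suc (card V - 1)" and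
    ws: "\<exists>ws. set ws \<subseteq> S \<and> length ws = card V - 1 \<and>
    snd (word_product W ws) permutes U \<and> cyclic_on (snd (word_product W ws)) U \<and>
    (\<forall>x\<in>X. fst (word_product W ws) x = \<one>\<^bsub>H\<^esub>)"
    by (elim exE conjE) (rule that, assumption+, intro exI conjI)
  have "U = V" by (rule card_subset_eq[OF V(1) U(1)]) (use U(2) pos in simp)
  then show ?thesis using ws by simp
qed

lemma ex_word_cycle_with_product:
  assumes V: "finite V" "V \<subseteq> X" "graph_connected V E" and E: "E \<subseteq> transposition_graph H X S_X"
    and S_X: "S_X \<subseteq> T_X H X" and u: "u \<in> V" and a: "a \<in> carrier H"
    and S_H: "a \<noteq> \<one>\<^bsub>H\<^esub> \<Longrightarrow> single_elt H X u a \<in> S_H"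
  shows "\<exists>ws. set ws \<subseteq> S_H \<union> S_X \<and> length ws = (if a = \<one>\<^bsub>H\<^esub> then card V - 1 else card V) \<and>
    word_product W ws \<in> carrier W \<and>
    snd (word_product W ws) permutes V \<and> cyclic_on (snd (word_product W ws)) V \<and>
    (\<forall>x\<in>X. fst (word_product W ws) x = (if x = u then a else \<one>\<^bsub>H\<^esub>))"
proof -
  obtain ws where ws: "set ws \<subseteq> S_X" "length ws = card V - 1"
    "snd (word_product W ws) permutes V" "cyclic_on (snd (word_product W ws)) V"
    "\<And>x. x \<in> X \<Longrightarrow> fst (word_product W ws) x = \<one>\<^bsub>H\<^esub>"
    using ex_word_cycle[OF V E S_X] by auto
  have wW: "word_product W ws \<in> carrier W"
    using ws(1) S_X T_closed by (intro W.word_product_closed) auto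
  show ?thesis
  proof (cases "a = \<one>\<^bsub>H\<^esub>")
    case True
    then show ?thesis using ws wW by (intro exI[of _ ws]) auto
  next
    case False
    have uX: "u \<in> X" using u V by auto
    have s: "single_elt H X u a \<in> carrier W" using single_elt_closed[OF uX a] .
    \<comment> \<open>A letter from \<open>H\<close> in front alters only the label at
      \<open>u\<close> and leaves the permutation unchanged.\<close>
    have "fst (single_elt H X u a \<otimes>\<^bsub>W\<^esub> word_product W ws) x = (if x = u then a else \<one>\<^bsub>H\<^esub>)" if "x \<in> X" for x
      using fst_W_mult[OF s that, of "word_product W ws"] ws(5)[OF that] that a by (simp add: fst_single_elt)
    moreover have "card V > 0" using u V by (auto simp: card_gt_0_iff)
    ultimately show ?thesis
      using ws(1-4) wW s S_H[OF False] False by (intro exI[of _ "single_elt H X u a # ws"]) auto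
  qed
qed

text \<open>The words of different trees act on disjoint vertex sets: the new word moves and
  relabels only points on which the previous product is trivial, so concatenation preserves the
  cycles already built.\<close>

lemma ex_word_cycles:
  fixes n :: nat
  assumes forest: "\<And>i. i < n \<Longrightarrow> finite (V i) \<and> V i \<subseteq> X \<and> graph_connected (V i) (E i) \<and>
      E i \<subseteq> transposition_graph H X S_X \<and> u i \<in> V i \<and> a i \<in> carrier H \<and>
      (a i \<noteq> \<one>\<^bsub>H\<^esub> \<longrightarrow> single_elt H X (u i) (a i) \<in> S_H)"
    and disj: "\<And>i j. i < n \<Longrightarrow> j < n \<Longrightarrow> i \<noteq> j \<Longrightarrow> V i \<inter> V j = {}"
    and S_X: "S_X \<subseteq> T_X H X" and S_H: "S_H \<subseteq> T_H H X"
  shows "\<exists>ws. set ws \<subseteq> S_H \<union> S_X \<and>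
    length ws = (\<Sum>i<n. if a i = \<one>\<^bsub>H\<^esub> then card (V i) - 1 else card (V i)) \<and>
    word_product W ws \<in> carrier W \<and>
    (\<forall>i<n. cyclic_on (snd (word_product W ws)) (V i)) \<and>
    (\<forall>i<n. \<forall>x\<in>V i. fst (word_product W ws) x = (if x = u i then a i else \<one>\<^bsub>H\<^esub>)) \<and>
    (\<forall>x\<in>X. x \<notin> (\<Union>i<n. V i) \<longrightarrow> snd (word_product W ws) x = x \<and> fst (word_product W ws) x = \<one>\<^bsub>H\<^esub>)"
  using forest disj
proof (induction n)
  case 0
  show ?case by (intro exI[of _ "[]"]) (simp add: fst_W_one)
next
  case (Suc n)
  have "\<exists>ws. set ws \<subseteq> S_H \<union> S_X \<and>
    length ws = (\<Sum>i<n. if a i = \<one>\<^bsub>H\<^esub> then card (V i) - 1 else card (V i)) \<and>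
    word_product W ws \<in> carrier W \<and>
    (\<forall>i<n. cyclic_on (snd (word_product W ws)) (V i)) \<and>
    (\<forall>i<n. \<forall>x\<in>V i. fst (word_product W ws) x = (if x = u i then a i else \<one>\<^bsub>H\<^esub>)) \<and>
    (\<forall>x\<in>X. x \<notin> (\<Union>i<n. V i) \<longrightarrow> snd (word_product W ws) x = x \<and> fst (word_product W ws) x = \<one>\<^bsub>H\<^esub>)"
    using Suc.prems by (intro Suc.IH) auto
  then obtain ws where ws: "set ws \<subseteq> S_H \<union> S_X"
    "length ws = (\<Sum>i<n. if a i = \<one>\<^bsub>H\<^esub> then card (V i) - 1 else card (V i))"
    and gW: "word_product W ws \<in> carrier W"
    and cyc: "\<And>i. i < n \<Longrightarrow> cyclic_on (snd (word_product W ws)) (V i)"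
    and fst_g: "\<And>i x. i < n \<Longrightarrow> x \<in> V i \<Longrightarrow> fst (word_product W ws) x = (if x = u i then a i else \<one>\<^bsub>H\<^esub>)"
    and out: "\<And>x. x \<in> X \<Longrightarrow> x \<notin> (\<Union>i<n. V i) \<Longrightarrow> snd (word_product W ws) x = x \<and> fst (word_product W ws) x = \<one>\<^bsub>H\<^esub>"
    by blast
  have Vn: "finite (V n)" "V n \<subseteq> X" "graph_connected (V n) (E n)" "E n \<subseteq> transposition_graph H X S_X"
    "u n \<in> V n" "a n \<in> carrier H" "a n \<noteq> \<one>\<^bsub>H\<^esub> \<Longrightarrow> single_elt H X (u n) (a n) \<in> S_H"
    using Suc.prems(1)[of n] by auto
  obtain us where us: "set us \<subseteq> S_H \<union> S_X"
    "length us = (if a n = \<one>\<^bsub>H\<^esub> then card (V n) - 1 else card (V n))"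
    "word_product W us \<in> carrier W" "snd (word_product W us) permutes V n" "cyclic_on (snd (word_product W us)) (V n)"
    "\<And>x. x \<in> X \<Longrightarrow> fst (word_product W us) x = (if x = u n then a n else \<one>\<^bsub>H\<^esub>)"
    using ex_word_cycle_with_product[OF Vn(1-4) S_X Vn(5-7)] by auto
  define g where "g = word_product W ws"
  define d where "d = word_product W us"
  have dW: "d \<in> carrier W" and pd: "snd d permutes V n" using us by (auto simp: d_def)
  have disjn: "V i \<inter> V n = {}" if "i < n" for i using Suc.prems(2)[of i n] that by auto
  have VX: "V i \<subseteq> X" if "i < Suc n" for i using Suc.prems(1) that by blast
  have prod: "word_product W (us @ ws) = d \<otimes>\<^bsub>W\<^esub> g"
  proof -
    have "set us \<subseteq> carrier W" "set ws \<subseteq> carrier W"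
      using us(1) ws(1) S_X S_H T_closed by blast+
    then show ?thesis unfolding d_def g_def by (rule W.word_product_append)
  qed
  have fix_out: "snd g x = x \<and> fst g x = \<one>\<^bsub>H\<^esub>" if "x \<in> V n" for x
    using out[of x] that disjn Vn(2) by (fastforce simp: g_def)
  have cyc': "cyclic_on (snd d \<circ> snd g) (V i)" if "i < Suc n" for i
  proof (cases "i = n")
    case True
    have "cyclic_on (snd d \<circ> snd g) (V n) = cyclic_on (snd d) (V n)"
      by (rule cyclic_cong) (simp add: fix_out)
    then show ?thesis using True us by (simp add: d_def)
  next
    case False
    then have i: "i < n" using that by simp
    have "cyclic_on (snd d \<circ> snd g) (V i) = cyclic_on (snd g) (V i)"
    proof (rule cyclic_cong)
      fix x assume "x \<in> V i"
      then have "snd g x \<notin> V n" using cyclic_on_inI[OF cyc[OF i]] disjn[OF i] by (auto simp: g_def)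
      then show "(snd d \<circ> snd g) x = snd g x" using permutes_not_in[OF pd] by simp
    qed
    then show ?thesis using cyc[OF i] by (simp add: g_def)
  qed
  have fst_dg: "fst (d \<otimes>\<^bsub>W\<^esub> g) x = (if x \<in> V n then fst d x else fst g x)" if x: "x \<in> X" for x
  proof (cases "x \<in> V n")
    case True
    then obtain y where y: "y \<in> V n" "x = snd d y" using permutes_image[OF pd] by blast
    have "fst d x \<in> carrier H" using fst_W_closed[OF dW] x by blast
    then show ?thesis
      using True y fst_W_mult[OF dW, of y g] Vn(2) fix_out[OF y(1)] by auto
  next
    case False
    have "fst d x = \<one>\<^bsub>H\<^esub>" using us(6)[OF x] False Vn(5) by (auto simp: d_def)
    moreover have "snd d x = x" using pd False by (simp add: permutes_not_in)
    moreover have "fst g x \<in> carrier H" using fst_W_closed[OF gW] x by (simp add: g_def)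
    ultimately show ?thesis using fst_W_mult[OF dW x, of g] False by simp
  qed
  have "fst (d \<otimes>\<^bsub>W\<^esub> g) x = (if x = u i then a i else \<one>\<^bsub>H\<^esub>)" if i: "i < Suc n" and x: "x \<in> V i" for i x
  proof (cases "i = n")
    case True
    then show ?thesis using fst_dg[of x] us(6)[of x] x VX[OF i] by (auto simp: d_def)
  next
    case False
    then have "i < n" "x \<in> X" "x \<notin> V n" using i x VX[OF i] disjn[of i] by auto
    then show ?thesis using fst_dg[of x] fst_g[of i x] x by (simp add: g_def)
  qed
  moreover have "snd (d \<otimes>\<^bsub>W\<^esub> g) x = x \<and> fst (d \<otimes>\<^bsub>W\<^esub> g) x = \<one>\<^bsub>H\<^esub>" if "x \<in> X" "x \<notin> (\<Union>i<Suc n. V i)" for x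
    using that fst_dg[of x] out[of x] pd by (auto simp: g_def permutes_not_in less_Suc_eq)
  moreover have "d \<otimes>\<^bsub>W\<^esub> g \<in> carrier W" using dW gW by (simp add: g_def)
  moreover have "cyclic_on (snd (d \<otimes>\<^bsub>W\<^esub> g)) (V i)" if "i < Suc n" for i
    using cyc'[OF that] by (simp only: snd_W_mult)
  moreover have "set (us @ ws) \<subseteq> S_H \<union> S_X"
    "length (us @ ws) = (\<Sum>i<Suc n. if a i = \<one>\<^bsub>H\<^esub> then card (V i) - 1 else card (V i))"
    using us(1,2) ws by auto
  ultimately show ?case unfolding prod[symmetric] by blast
qed

lemma image_mset_nth_mset_set: "image_mset ((!) xs) (mset_set {..<length xs}) = mset xs"
proof -
  have "image_mset ((!) xs) (mset [0..<length xs]) = mset xs"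
    by (simp only: mset_map[symmetric] map_nth)
  then show ?thesis by (simp add: atLeast0LessThan)
qed

text \<open>The product starts with the label of the successor of \<open>u\<close>, so the label at
  \<open>u\<close> is met only as the last factor, on the return to \<open>u\<close>.\<close>

lemma cycle_product_single:
  assumes A: "cyclic_on (snd g) A" and u: "u \<in> A" and a: "a \<in> carrier H"
    and f: "\<And>x. x \<in> A \<Longrightarrow> fst g x = (if x = u then a else \<one>\<^bsub>H\<^esub>)"
  shows "cycle_product H g (card A) u = a"
proof -
  have in_A: "(snd g ^^ n) u \<in> A" for n by (rule cyclic_on_funpow_in[OF A u])
  have "cycle_product H g n u = \<one>\<^bsub>H\<^esub>" if "n < card A" for n
    using that
  proof (induction n)
    case (Suc n)
    have "(snd g ^^ Suc n) u \<noteq> (snd g ^^ 0) u"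
      using bij_betw_cyclic_on[OF A u] Suc.prems inj_onD[of "\<lambda>i. (snd g ^^ i) u" "{..<card A}" "Suc n" 0]
      by (auto simp: bij_betw_def)
    then have "fst g ((snd g ^^ Suc n) u) = \<one>\<^bsub>H\<^esub>" using f[OF in_A[of "Suc n"]] by simp
    then show ?case using Suc by simp
  qed simp
  moreover have "0 < card A" using finite_cyclic_on[OF A] u by (auto simp: card_gt_0_iff)
  then obtain k where k: "card A = Suc k" by (cases "card A") auto
  moreover have "fst g ((snd g ^^ card A) u) = a" using funpow_card_cyclic_on[OF A u] f[OF u] by simp
  ultimately show ?thesis using a by (simp del: funpow.simps)
qed

lemma ex_word_of_cycle_type:
  assumes S: "PCwr H X S" and M: "set_mset M \<subseteq> conj_classes H \<times> {1..}"
  shows "\<exists>ws. set ws \<subseteq> S \<and> length ws = (\<Sum>t\<in>#M. snd t) \<and> word_product W ws \<in> carrier W \<and>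
    cycle_type H X (word_product W ws) = M"
proof -
  \<comment> \<open>Recovers the cycle length from the cost; this is the number of vertices
    requested for the tree.\<close>
  define size where "size t = (if fst t = {\<one>\<^bsub>H\<^esub>} then Suc (snd t) else snd t)" for t :: "'h set \<times> nat"
  obtain xs where xs: "mset xs = M" by (metis ex_mset)
  \<comment> \<open>\<open>is_partition\<close> asks for parts in weakly decreasing order, whereas
    \<open>sort_key\<close> sorts increasingly.\<close>
  define ts where "ts = rev (sort_key size xs)"
  have ts: "mset ts = M" "sorted_wrt (\<ge>) (map size ts)"
    by (simp_all add: ts_def xs sorted_wrt_rev flip: rev_map)
  have tsC: "t \<in> conj_classes H \<times> {1..}" if "t \<in> set ts" for t
    using that M ts(1) by (metis set_mset_mset subsetD)
  have "is_partition (sum_list (map size ts)) (map size ts)"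
    using ts(2) tsC by (fastforce simp: is_partition_def size_def)
  moreover obtain S_H S_X where SS: "S_H \<subseteq> T_H H X" "S_X \<subseteq> T_X H X" "S = S_H \<union> S_X"
    and pc: "\<forall>L ls. is_partition L ls \<longrightarrow>
           (\<exists>V E. (\<forall>i<length ls. graph_tree (V i) (E i) \<and> V i \<subseteq> X \<and>
                      E i \<subseteq> transposition_graph H X S_X \<and> card (V i) = ls ! i \<and>
                      (\<exists>x\<in>V i. \<forall>a\<in>carrier H - {\<one>\<^bsub>H\<^esub>}. single_elt H X x a \<in> S_H)) \<and>
                  (\<forall>i<length ls. \<forall>j<length ls. i \<noteq> j \<longrightarrow> V i \<inter> V j = {}))"
    using S unfolding PCwr_def by (elim exE conjE) (rule that)
  ultimately have "\<exists>V E. (\<forall>i<length ts. graph_tree (V i) (E i) \<and> V i \<subseteq> X \<and>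
        E i \<subseteq> transposition_graph H X S_X \<and> card (V i) = size (ts ! i) \<and>
        (\<exists>x\<in>V i. \<forall>a\<in>carrier H - {\<one>\<^bsub>H\<^esub>}. single_elt H X x a \<in> S_H)) \<and>
      (\<forall>i<length ts. \<forall>j<length ts. i \<noteq> j \<longrightarrow> V i \<inter> V j = {})"
    using pc[rule_format, of "sum_list (map size ts)" "map size ts"] by simp
  then obtain V E where VE: "(\<forall>i<length ts. graph_tree (V i) (E i) \<and> V i \<subseteq> X \<and>
        E i \<subseteq> transposition_graph H X S_X \<and> card (V i) = size (ts ! i) \<and>
        (\<exists>x\<in>V i. \<forall>a\<in>carrier H - {\<one>\<^bsub>H\<^esub>}. single_elt H X x a \<in> S_H)) \<and>
      (\<forall>i<length ts. \<forall>j<length ts. i \<noteq> j \<longrightarrow> V i \<inter> V j = {})"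
    by (elim exE) (rule that)
  have V: "\<And>i. i < length ts \<Longrightarrow> graph_tree (V i) (E i) \<and> V i \<subseteq> X \<and>
        E i \<subseteq> transposition_graph H X S_X \<and> card (V i) = size (ts ! i) \<and>
        (\<exists>x\<in>V i. \<forall>a\<in>carrier H - {\<one>\<^bsub>H\<^esub>}. single_elt H X x a \<in> S_H)"
    and disj: "\<And>i j. i < length ts \<Longrightarrow> j < length ts \<Longrightarrow> i \<noteq> j \<Longrightarrow> V i \<inter> V j = {}"
    using VE by blast+
  define n where "n = length ts"
  have "\<forall>i. \<exists>x. i < n \<longrightarrow> x \<in> V i \<and> (\<forall>a\<in>carrier H - {\<one>\<^bsub>H\<^esub>}. single_elt H X x a \<in> S_H)"
    using VE unfolding n_def by blast
  from choice[OF this] obtain u where u: "\<And>i. i < n \<Longrightarrow> u i \<in> V i"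
    "\<And>i a. i < n \<Longrightarrow> a \<in> carrier H - {\<one>\<^bsub>H\<^esub>} \<Longrightarrow> single_elt H X (u i) a \<in> S_H" by blast
  have ti: "ts ! i \<in> conj_classes H \<times> {1..}" if "i < n" for i using that tsC by (simp add: n_def)
  have "\<forall>i. \<exists>a. i < n \<longrightarrow> a \<in> carrier H \<and> conj_class H a = fst (ts ! i)"
    using ti by (fastforce simp: conj_classes_def)
  from choice[OF this] obtain a where a: "\<And>i. i < n \<Longrightarrow> a i \<in> carrier H"
    "\<And>i. i < n \<Longrightarrow> conj_class H (a i) = fst (ts ! i)" by blast
  have a1: "fst (ts ! i) = {\<one>\<^bsub>H\<^esub>} \<longleftrightarrow> a i = \<one>\<^bsub>H\<^esub>" if "i < n" for i
    using H.conj_class_eq_one_iff[OF a(1)[OF that]] a(2)[OF that] by simp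
  have cardV: "card (V i) = (if a i = \<one>\<^bsub>H\<^esub> then Suc (snd (ts ! i)) else snd (ts ! i))" if "i < n" for i
    using V[of i] that a1[OF that] by (simp add: n_def size_def)
  have pos: "0 < snd (ts ! i)" if "i < n" for i using ti[OF that] by (auto simp: mem_Times_iff)
  \<comment> \<open>Infinite sets have cardinality 0, so positive cardinality gives
    finiteness.\<close>
  have finV: "finite (V i)" if "i < n" for i
    using cardV[OF that] pos[OF that] by (intro card_ge_0_finite) auto
  have VX: "V i \<subseteq> X" if "i < n" for i using V[of i] that by (simp add: n_def)
  have forest: "finite (V i) \<and> V i \<subseteq> X \<and> graph_connected (V i) (E i) \<and>
      E i \<subseteq> transposition_graph H X S_X \<and> u i \<in> V i \<and> a i \<in> carrier H \<and>
      (a i \<noteq> \<one>\<^bsub>H\<^esub> \<longrightarrow> single_elt H X (u i) (a i) \<in> S_H)" if "i < n" for i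
    using V[of i] u(1)[OF that] u(2)[OF that] a(1)[OF that] finV[OF that] that by (simp add: n_def graph_tree_def)
  obtain ws where ws: "set ws \<subseteq> S_H \<union> S_X"
    "length ws = (\<Sum>i<n. if a i = \<one>\<^bsub>H\<^esub> then card (V i) - 1 else card (V i))"
    "word_product W ws \<in> carrier W"
    "\<forall>i<n. cyclic_on (snd (word_product W ws)) (V i)"
    "\<forall>i<n. \<forall>x\<in>V i. fst (word_product W ws) x = (if x = u i then a i else \<one>\<^bsub>H\<^esub>)"
    "\<forall>x\<in>X. x \<notin> (\<Union>i<n. V i) \<longrightarrow> snd (word_product W ws) x = x \<and> fst (word_product W ws) x = \<one>\<^bsub>H\<^esub>"
    by (rule exE[OF ex_word_cycles[of n V E S_X u a S_H]], erule forest, erule (2) disj[folded n_def],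
      rule SS(2), rule SS(1), elim conjE, rule that)
  define g where "g = word_product W ws"
  have gs: "g \<in> carrier W" "\<And>i. i < n \<Longrightarrow> cyclic_on (snd g) (V i)"
    "\<And>i x. i < n \<Longrightarrow> x \<in> V i \<Longrightarrow> fst g x = (if x = u i then a i else \<one>\<^bsub>H\<^esub>)"
    "\<And>x. x \<in> X \<Longrightarrow> x \<notin> (\<Union>i<n. V i) \<Longrightarrow> snd g x = x \<and> fst g x = \<one>\<^bsub>H\<^esub>"
    unfolding g_def using ws(3-6) by blast+
  have cprod: "cycle_product H g (card (V i)) (u i) = a i" if "i < n" for i
    by (rule cycle_product_single[OF gs(2)[OF that] u(1)[OF that] a(1)[OF that]]) (rule gs(3)[OF that])
  have cls: "cycle_class H g (V i) = ts ! i" if i: "i < n" for i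
    unfolding cycle_class_eq[OF gs(1) VX[OF i] gs(2)[OF i] u(1)[OF i]] cprod[OF i]
    using a(2)[OF i] cardV[OF i] by (auto intro!: prod_eqI)
  have cyc: "cycles_of H X g = V ` {..<n}"
  proof (intro equalityI subsetI)
    fix A assume A: "A \<in> cycles_of H X g"
    then obtain x where x: "x \<in> A" "x \<in> X" "snd g x \<noteq> x \<or> fst g x \<noteq> \<one>\<^bsub>H\<^esub>"
      by (auto simp: cycles_of_def)
    then obtain i where i: "i < n" "x \<in> V i" using gs(4) by blast
    then have "A = V i" using cyclic_on_disjoint[OF cycles_ofD(2)[OF A] gs(2)[OF i(1)]] x(1) by blast
    then show "A \<in> V ` {..<n}" using i by blast
  next
    fix A assume "A \<in> V ` {..<n}"
    then obtain i where i: "i < n" "A = V i" by blast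
    \<comment> \<open>With a trivial label the cycle has length cost plus 1, hence at least 2, and
      moves \<open>u i\<close>; otherwise the label at \<open>u i\<close> is nontrivial.\<close>
    have "snd g (u i) \<noteq> u i \<or> fst g (u i) \<noteq> \<one>\<^bsub>H\<^esub>"
    proof (cases "a i = \<one>\<^bsub>H\<^esub>")
      case True
      have "snd g (u i) = u i \<longleftrightarrow> card (V i) = 1"
        using eq_on_cyclic_on_iff1[OF gs(2)[OF i(1)] u(1)[OF i(1)]] by blast
      then show ?thesis using cardV[OF i(1)] True pos[OF i(1)] by simp
    next
      case False
      then show ?thesis using gs(3)[OF i(1) u(1)[OF i(1)]] by simp
    qed
    then show "A \<in> cycles_of H X g"
      using i u(1)[OF i(1)] VX[OF i(1)] gs(2)[OF i(1)] by (auto simp: cycles_of_def)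
  qed
  have "inj_on V {..<n}"
  proof (rule inj_onI)
    fix i j assume "i \<in> {..<n}" "j \<in> {..<n}" "V i = V j"
    then show "i = j" using disj[of i j] u(1)[of i] by (auto simp: n_def)
  qed
  then have "cycle_type H X g = image_mset (\<lambda>i. cycle_class H g (V i)) (mset_set {..<n})"
    by (simp add: cycle_type_def cyc image_mset_mset_set[symmetric] multiset.map_comp comp_def)
  also have "\<dots> = image_mset ((!) ts) (mset_set {..<n})"
    by (rule image_mset_cong) (simp add: cls)
  also have "\<dots> = M" unfolding n_def image_mset_nth_mset_set by (rule ts(1))
  finally have "cycle_type H X g = M" .
  moreover have "length ws = (\<Sum>t\<in>#M. snd t)"
  proof -
    have "length ws = (\<Sum>i<n. snd (ts ! i))"
      unfolding ws(2) by (rule sum.cong) (auto simp: cardV)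
    also have "\<dots> = (\<Sum>t\<in>#image_mset ((!) ts) (mset_set {..<n}). snd t)"
      by (simp add: sum_unfold_sum_mset multiset.map_comp comp_def)
    finally show ?thesis unfolding n_def image_mset_nth_mset_set ts(1) .
  qed
  ultimately show ?thesis using ws(1) gs(1) SS(3) unfolding g_def by blast
qed

text \<open>Cost 0 would require a single point with trivial cycle product. Its product is its
  label, and \<open>cycles_of\<close> excludes fixed points with trivial label.\<close>

lemma cycle_type_classes:
  assumes g: "g \<in> carrier W"
  shows "set_mset (cycle_type H X g) \<subseteq> conj_classes H \<times> {1..}"
proof
  fix t assume "t \<in> set_mset (cycle_type H X g)"
  then obtain A where A: "A \<in> cycles_of H X g" "t = cycle_class H g A"
    using finite_cycles_of[OF g] by (auto simp: cycle_type_def)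
  note A' = cycles_ofD[OF A(1)]
  obtain x where x: "x \<in> A" "snd g x \<noteq> x \<or> fst g x \<noteq> \<one>\<^bsub>H\<^esub>" using A(1) by (auto simp: cycles_of_def)
  have xX: "x \<in> X" using x A' by auto
  define p where "p = cycle_product H g (card A) x"
  have p: "p \<in> carrier H" unfolding p_def using xX by (rule cycle_product_closed[OF g])
  have pos: "0 < card A" using A' by (simp add: card_gt_0_iff)
  have "card A \<noteq> 1" if "p = \<one>\<^bsub>H\<^esub>"
  proof
    assume c: "card A = 1"
    then have "snd g x = x" using eq_on_cyclic_on_iff1[OF A'(2) x(1)] by blast
    moreover have "fst g x \<in> carrier H" using fst_W_closed[OF g xX] .
    ultimately have "p = fst g x" using c by (simp add: p_def)
    then show False using that x(2) \<open>snd g x = x\<close> by simp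
  qed
  then have "1 \<le> (if p = \<one>\<^bsub>H\<^esub> then card A - 1 else card A)" using pos by auto
  then show "t \<in> conj_classes H \<times> {1..}"
    unfolding A(2) cycle_class_eq[OF g A'(1,2) x(1)] p_def[symmetric] using p by (auto simp: conj_classes_def)
qed

section \<open>Conjugacy length and conjugacy growth\<close>

lemma PCwr_subset_T: "PCwr H X S \<Longrightarrow> S \<subseteq> T_H H X \<union> T_X H X"
  unfolding PCwr_def by (elim exE conjE) (simp only: Un_mono)

lemma word_length_ge:
  assumes S: "PCwr H X S" and gen: "generate W S = carrier W" and g: "g \<in> carrier W"
  shows "(\<Sum>t\<in>#cycle_type H X g. snd t) \<le> word_length W S g"
proof -
  have T: "S \<union> m_inv W ` S \<subseteq> T_H H X \<union> T_X H X"
    using PCwr_subset_T[OF S] T_inv_closed by blast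
  have "\<exists>ws. set ws \<subseteq> S \<union> m_inv W ` S \<and> g = word_product W ws"
    using W.generate_imp_word[of S g] PCwr_subset_T[OF S] T_closed gen g by blast
  then have "\<exists>n ws. length ws = n \<and> set ws \<subseteq> S \<union> m_inv W ` S \<and> g = word_product W ws" by blast
  then have "\<exists>ws. length ws = word_length W S g \<and> set ws \<subseteq> S \<union> m_inv W ` S \<and> g = word_product W ws"
    unfolding word_length_def by (rule LeastI_ex)
  then obtain ws where ws: "length ws = word_length W S g" "set ws \<subseteq> S \<union> m_inv W ` S"
    and g_ws: "g = word_product W ws"
    by (elim exE conjE) (rule that)
  show ?thesis
    using cycle_type_weight_le_length[OF order_trans[OF ws(2) T] g_ws] by (simp only: ws(1))
qed

lemma conj_length_eq:
  assumes S: "PCwr H X S" and gen: "generate W S = carrier W" and g: "g \<in> carrier W"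
  shows "conj_length W S g = (\<Sum>t\<in>#cycle_type H X g. snd t)"
  unfolding conj_length_def
proof (rule Least_equality)
  \<comment> \<open>The element spelled by \<open>ws\<close> need not be \<open>g\<close>; equality
    of cycle types makes it conjugate to \<open>g\<close>, which is enough for the minimum over the
    class.\<close>
  obtain ws where ws: "set ws \<subseteq> S" "length ws = (\<Sum>t\<in>#cycle_type H X g. snd t)"
    "word_product W ws \<in> carrier W" "cycle_type H X (word_product W ws) = cycle_type H X g"
    using ex_word_of_cycle_type[OF S cycle_type_classes[OF g]] by blast
  define g' where "g' = word_product W ws"
  have g': "g' \<in> carrier W" "cycle_type H X g' = cycle_type H X g" using ws by (auto simp: g'_def)
  have "conj_class W g' = conj_class W g" using conj_class_W_eq_iff[OF g'(1) g] g'(2) by blast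
  then have "g' \<in> conj_class W g" using W.conj_class_self[OF g'(1)] by simp
  moreover have "word_length W S g' \<le> length ws"
    unfolding word_length_def by (rule Least_le) (use ws(1) in \<open>auto simp: g'_def intro!: exI[of _ ws]\<close>)
  then have "word_length W S g' = (\<Sum>t\<in>#cycle_type H X g. snd t)"
    using word_length_ge[OF S gen g'(1)] ws(2) g'(2) by simp
  ultimately show "(\<Sum>t\<in>#cycle_type H X g. snd t) \<in> word_length W S ` conj_class W g" by (metis imageI)
next
  fix n assume "n \<in> word_length W S ` conj_class W g"
  then obtain g' where g': "g' \<in> conj_class W g" "n = word_length W S g'" by blast
  then have "g' \<in> carrier W" "\<exists>h\<in>carrier W. h \<otimes>\<^bsub>W\<^esub> g = g' \<otimes>\<^bsub>W\<^esub> h" using W.mem_conj_class_iff[OF g] by auto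
  then have "cycle_type H X g' = cycle_type H X g" using cycle_type_conj[OF g] by metis
  then show "(\<Sum>t\<in>#cycle_type H X g. snd t) \<le> n"
    using word_length_ge[OF S gen \<open>g' \<in> carrier W\<close>] g'(2) by simp
qed

lemma conj_growth_eq:
  assumes S: "PCwr H X S" and gen: "generate W S = carrier W"
  shows "conj_growth W S n = card (coloured_partitions (conj_classes H) n)"
proof -
  define D where "D = {g \<in> carrier W. conj_length W S g = n}"
  have D: "D = {g \<in> carrier W. (\<Sum>t\<in>#cycle_type H X g. snd t) = n}"
    using conj_length_eq[OF S gen] by (auto simp: D_def)
  have iff: "conj_class W g = conj_class W g' \<longleftrightarrow> cycle_type H X g = cycle_type H X g'" if "g \<in> D" "g' \<in> D" for g g'
    using that conj_class_W_eq_iff by (auto simp: D_def)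
  have "cycle_type H X ` D = coloured_partitions (conj_classes H) n"
  proof (intro equalityI subsetI)
    fix M assume "M \<in> cycle_type H X ` D"
    then show "M \<in> coloured_partitions (conj_classes H) n"
      using cycle_type_classes by (auto simp: D coloured_partitions_def)
  next
    fix M assume "M \<in> coloured_partitions (conj_classes H) n"
    then show "M \<in> cycle_type H X ` D"
      using ex_word_of_cycle_type[OF S, of M] by (fastforce simp: D coloured_partitions_def)
  qed
  \<comment> \<open>On \<open>D\<close> the maps \<open>conj_class W\<close> and
    \<open>cycle_type H X\<close> have the same fibres, so sending a class to the type of a chosen
    representative matches their images.\<close>
  moreover have "bij_betw (\<lambda>c. cycle_type H X (inv_into D (conj_class W) c)) (conj_class W ` D) (cycle_type H X ` D)"
  proof (rule bij_betw_imageI)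
    have inv: "inv_into D (conj_class W) c \<in> D \<and> conj_class W (inv_into D (conj_class W) c) = c"
      if "c \<in> conj_class W ` D" for c
      using inv_into_into[OF that] f_inv_into_f[OF that] by blast
    show "inj_on (\<lambda>c. cycle_type H X (inv_into D (conj_class W) c)) (conj_class W ` D)"
      using inv iff by (intro inj_onI) metis
    have "cycle_type H X (inv_into D (conj_class W) (conj_class W g)) = cycle_type H X g" if "g \<in> D" for g
      using that inv[of "conj_class W g"] iff[of g "inv_into D (conj_class W) (conj_class W g)"] by auto
    then show "(\<lambda>c. cycle_type H X (inv_into D (conj_class W) c)) ` conj_class W ` D = cycle_type H X ` D"
      by (simp add: image_image)
  qed
  ultimately have "card (conj_class W ` D) = card (coloured_partitions (conj_classes H) n)"
    using bij_betw_same_card by metis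
  moreover have "{conj_class W g | g. g \<in> carrier W \<and> conj_length W S g = n} = conj_class W ` D"
    by (auto simp: D_def)
  ultimately show ?thesis by (simp add: conj_growth_def)
qed

end

theorem corollary5:
  fixes H :: "('h, 'm) monoid_scheme"
    and X :: "'x set"
    and S :: "(('x \<Rightarrow> 'h) \<times> ('x \<Rightarrow> 'x)) set"
  assumes "group H" and "finite (carrier H)"
    and "infinite X"
    and "generate (wreath H X) S = carrier (wreath H X)"
    and "PCwr H X S"
  shows "conj_growth_rate (wreath H X) S =
           ereal (pi * sqrt (2 * real (card (conj_classes H)) / 3))"
proof -
  interpret wreath_product H X by (rule wreath_product.intro) (rule assms(1))
  have "finite (conj_classes H)" unfolding conj_classes_def using assms(2) by (rule finite_imageI)
  moreover have "conj_classes H \<noteq> {}" unfolding conj_classes_def using H.one_closed by blast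
  ultimately show ?thesis
    unfolding conj_growth_rate_def conj_growth_eq[OF assms(5,4)]
    by (rule limsup_ln_card_coloured_partitions)
qed

end
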